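(* Let $S$ be any one-dimensional random walk (with i.i.d. increments) that oscillates. Then the measure $\pi_+$ is invariant for the Markov chains $(O_n)_{n\ge 0}$ and $(-U_n-d)_{n\ge 0}$ of overshoots and shifted sign-changed undershoots at up-crossings of the zero level, in the sense that $$\mathbb{P}_{\pi_+}(O_n\in\cdot)=\pi_+ \quad\text{and}\quad \mathbb{P}_{\pi_+}(-U_n-d\in\cdot)=\pi_+\qquad\text{for all } n\in\mathbb{N}.$$ Similarly, $\pi_-$ is an invariant measure for the chains $(O_n^\downarrow)_{n\ge0}$ and $(-U_n^\downarrow-d)_{n\ge 0}$, in the sense that $$\mathbb{P}_{\pi_-}(O_n^\downarrow\in\cdot)=\pi_- \quad\text{and}\quad \mathbb{P}_{\pi_-}(-U_n^\downarrow-d\in\cdot)=\pi_-\qquad\text{for all } n\in\mathbb{N}.$$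
   Context: $\mathbb{N}=\{1,2,\ldots\}$. $S_n=S_0+X_1+\cdots+X_n$, where $X_1,X_2,\ldots$ are i.i.d. non-degenerate real random variables and $S_0$ is independent of them. The walk $S$ oscillates if $\limsup_n S_n=+\infty$ and $\liminf_n S_n=-\infty$ a.s. Let $\mathcal{Z}_0=\mathbb{R}$ and $\mathcal{Z}_h=h\mathbb{Z}$ for $h>0$. The span of the distribution of $X_1$ is $d:=\sup\{h\in[0,\infty):\mathbb{P}(X_1\in\mathcal{Z}_h)=1\}\in[0,\infty)$. The walk always starts in $\mathcal{Z}_d$, so it stays in $\mathcal{Z}_d$. Put $\mathcal{Z}_d^+=\mathcal{Z}_d\cap[0,\infty)$ and $\mathcal{Z}_d^-=\mathcal{Z}_d\cap(-\infty,0)$. Let $\lambda_0$ be Lebesgue measure on $\mathbb{R}$ and, for $d>0$, $\lambda_d(B)=d\cdot\#B$ for $B\subset\mathcal{Z}_d$; $\lambda_d^\pm$ denotes the restriction of $\lambda_d$ to $\mathcal{Z}_d^\pm$. The measures $\pi_\pm$ on $\mathcal{Z}_d$ are $$\pi_+(dx)=c_1\mathbb{P}(X_1>x)\lambda_d^+(dx),\qquad \pi_-(dx)=c_1\mathbb{P}(X_1\le x)\lambda_d^-(dx),$$ where $c_1=2/\mathbb{E}|X_1|$ if $\mathbb{E}|X_1|<\infty$ and $c_1=1$ if $\mathbb{E}|X_1|=\infty$ (the measures may then be infinite). $\mathbb{P}_x$ is the law under which $S_0=x$, and for a (not necessarily finite) Borel measure $\mu$ on $\mathcal{Z}_d$,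 $\mathbb{P}_\mu(\cdot)=\int\mathbb{P}_x(\cdot)\,\mu(dx)$. Up-crossing times: $T_0=0$, $T_n=\inf\{k>T_{n-1}:S_{k-1}<0,\ S_k\ge0\}$; overshoots and undershoots: $O_n=S_{T_n}$, $U_n=S_{T_n-1}$ for $n\in\mathbb{N}$, with $O_0=U_0=S_0$. Down-crossing times: $T_0^\downarrow=0$, $T_n^\downarrow=\inf\{k>T^\downarrow_{n-1}:S_{k-1}\ge0,\ S_k<0\}$; $O_n^\downarrow=S_{T_n^\downarrow}$, $U_n^\downarrow=S_{T_n^\downarrow-1}$ for $n\in\mathbb{N}$, with $O_0^\downarrow=U_0^\downarrow=S_0$. All these times are a.s. finite for an oscillating walk. *)

theory Defs
  imports "HOL-Probability.Probability"
begin

definition lattice :: "real \<Rightarrow> real set" where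
  "lattice h = (if h = 0 then UNIV else {h * of_int k | k :: int. True})"

definition span_of :: "'a measure \<Rightarrow> ('a \<Rightarrow> real) \<Rightarrow> real" where
  "span_of M Y = Sup {h. 0 \<le> h \<and> \<P>(\<omega> in M. Y \<omega> \<in> lattice h) = 1}"

(* A measure on Z_d is represented by the Borel measure on the real line that it induces,
   which gives no mass to the complement of Z_d. Here \<lambda>_d(B) = d * #(B \<inter> Z_d) for d > 0. *)
definition lattice_measure :: "real \<Rightarrow> real measure" where
  "lattice_measure d =
     (if d = 0 then lborel
      else scale_measure (ennreal d) (distr (count_space (lattice d)) borel (\<lambda>x. x)))"

definition lattice_measure_pos :: "real \<Rightarrow> real measure" where
  "lattice_measure_pos d = density (lattice_measure d) (indicator (lattice d \<inter> {0..}))"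

definition lattice_measure_neg :: "real \<Rightarrow> real measure" where
  "lattice_measure_neg d = density (lattice_measure d) (indicator (lattice d \<inter> {..<0}))"

definition norm_const :: "'a measure \<Rightarrow> ('a \<Rightarrow> real) \<Rightarrow> real" where
  "norm_const M Y = (if integrable M Y then 2 / (\<integral>\<omega>. \<bar>Y \<omega>\<bar> \<partial>M) else 1)"

definition pi_plus :: "'a measure \<Rightarrow> ('a \<Rightarrow> real) \<Rightarrow> real measure" where
  "pi_plus M Y = density (lattice_measure_pos (span_of M Y))
     (\<lambda>x. ennreal (norm_const M Y * \<P>(\<omega> in M. Y \<omega> > x)))"

definition pi_minus :: "'a measure \<Rightarrow> ('a \<Rightarrow> real) \<Rightarrow> real measure" where
  "pi_minus M Y = density (lattice_measure_neg (span_of M Y))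
     (\<lambda>x. ennreal (norm_const M Y * \<P>(\<omega> in M. Y \<omega> \<le> x)))"

(* The increments are X 1, X 2, ...; the value X 0 is never used. *)
definition walk :: "(nat \<Rightarrow> 'a \<Rightarrow> real) \<Rightarrow> real \<Rightarrow> 'a \<Rightarrow> nat \<Rightarrow> real" where
  "walk X x \<omega> n = x + (\<Sum>k=1..n. X k \<omega>)"

abbreviation path_space :: "(nat \<Rightarrow> real) measure" where
  "path_space \<equiv> Pi\<^sub>M UNIV (\<lambda>_. borel)"

definition walk_law :: "'a measure \<Rightarrow> (nat \<Rightarrow> 'a \<Rightarrow> real) \<Rightarrow> real \<Rightarrow> (nat \<Rightarrow> real) measure" where
  "walk_law M X x = distr M path_space (walk X x)"

(* With walk_law M X x in the role of P_x, this is P_\<mu> for the initial measure \<mu>.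
   Giry's bind is not used because \<mu> may be infinite. *)
definition walk_law_init ::
    "'a measure \<Rightarrow> (nat \<Rightarrow> 'a \<Rightarrow> real) \<Rightarrow> real measure \<Rightarrow> (nat \<Rightarrow> real) measure" where
  "walk_law_init M X \<mu> = measure_of (space path_space) (sets path_space)
     (\<lambda>A. \<integral>\<^sup>+ x. emeasure (walk_law M X x) A \<partial>\<mu>)"

(* Invariant under shifting the path by a constant, so for the walk to oscillate almost surely
   does not depend on its starting point. *)
definition oscillating :: "(nat \<Rightarrow> real) \<Rightarrow> bool" where
  "oscillating s \<longleftrightarrow>
     limsup (\<lambda>n. ereal (s n)) = \<infinity> \<and> liminf (\<lambda>n. ereal (s n)) = - \<infinity>"

(* The infimum of the empty set of natural numbers is 0; this convention matters only for
   paths with finitely many crossings, which form a null set for an oscillating walk. *)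
primrec up_time :: "(nat \<Rightarrow> real) \<Rightarrow> nat \<Rightarrow> nat" where
  "up_time s 0 = 0"
| "up_time s (Suc n) = Inf {k. k > up_time s n \<and> s (k - 1) < 0 \<and> s k \<ge> 0}"

primrec down_time :: "(nat \<Rightarrow> real) \<Rightarrow> nat \<Rightarrow> nat" where
  "down_time s 0 = 0"
| "down_time s (Suc n) = Inf {k. k > down_time s n \<and> s (k - 1) \<ge> 0 \<and> s k < 0}"

(* For n = 0 truncated subtraction gives the value s 0, as required. *)
definition overshoot_up :: "nat \<Rightarrow> (nat \<Rightarrow> real) \<Rightarrow> real" where
  "overshoot_up n s = s (up_time s n)"

definition undershoot_up :: "nat \<Rightarrow> (nat \<Rightarrow> real) \<Rightarrow> real" where
  "undershoot_up n s = s (up_time s n - 1)"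

definition overshoot_down :: "nat \<Rightarrow> (nat \<Rightarrow> real) \<Rightarrow> real" where
  "overshoot_down n s = s (down_time s n)"

definition undershoot_down :: "nat \<Rightarrow> (nat \<Rightarrow> real) \<Rightarrow> real" where
  "undershoot_down n s = s (down_time s n - 1)"

lemma walk_joint_measurable:
  assumes "\<And>k. k \<ge> 1 \<Longrightarrow> X k \<in> borel_measurable M"
  shows "(\<lambda>p. walk X (fst p) (snd p)) \<in> borel \<Otimes>\<^sub>M M \<rightarrow>\<^sub>M path_space"
  unfolding walk_def
proof (rule measurable_PiM_single')
  fix n :: nat
  have [measurable]: "X k \<in> borel_measurable M" if "k \<in> {1..n}" for k
    using assms that by auto
  show "(\<lambda>p. fst p + (\<Sum>k=1..n. X k (snd p))) \<in> borel_measurable (borel \<Otimes>\<^sub>M M)"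
    by measurable
qed auto

lemma emeasure_walk_law_init:
  assumes "prob_space M" "\<And>k. k \<ge> 1 \<Longrightarrow> X k \<in> borel_measurable M"
    and "sets \<mu> = sets borel" "A \<in> sets path_space"
  shows "emeasure (walk_law_init M X \<mu>) A = (\<integral>\<^sup>+ x. emeasure (walk_law M X x) A \<partial>\<mu>)"
proof -
  interpret prob_space M by fact
  note j = walk_joint_measurable[OF assms(2), simplified]
  have w: "walk X x \<in> M \<rightarrow>\<^sub>M path_space" for x
    using measurable_compose[OF measurable_Pair1'[of x borel M] j] by simp
  have meas: "(\<lambda>x. emeasure (walk_law M X x) B) \<in> borel_measurable \<mu>"
    if B: "B \<in> sets path_space" for B
  proof -
    let ?Q = "(\<lambda>p. walk X (fst p) (snd p)) -` B \<inter> space (borel \<Otimes>\<^sub>M M)"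
    have "?Q \<in> sets (borel \<Otimes>\<^sub>M M)" using j B by (rule measurable_sets)
    then have "(\<lambda>x. emeasure M (Pair x -` ?Q)) \<in> borel_measurable borel"
      by (rule measurable_emeasure_Pair)
    also have "(\<lambda>x. emeasure M (Pair x -` ?Q)) = (\<lambda>x. emeasure (walk_law M X x) B)"
      by (auto simp: walk_law_def emeasure_distr[OF w B] space_pair_measure
          intro!: ext arg_cong[where f = "emeasure M"])
    finally show ?thesis using assms(3) by (simp cong: measurable_cong_sets)
  qed
  show ?thesis
    unfolding walk_law_init_def
  proof (rule emeasure_measure_of_sigma[OF _ _ _ assms(4)])
    show "sigma_algebra (space path_space) (sets path_space)" by (rule sets.sigma_algebra_axioms)
    show "positive (sets path_space) (\<lambda>A. \<integral>\<^sup>+ x. emeasure (walk_law M X x) A \<partial>\<mu>)"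
      by (simp add: positive_def)
    show "countably_additive (sets path_space) (\<lambda>A. \<integral>\<^sup>+ x. emeasure (walk_law M X x) A \<partial>\<mu>)"
    proof (rule countably_additiveI)
      fix F :: "nat \<Rightarrow> (nat \<Rightarrow> real) set"
      assume F: "range F \<subseteq> sets path_space" "disjoint_family F"
      have "(\<Sum>i. \<integral>\<^sup>+ x. emeasure (walk_law M X x) (F i) \<partial>\<mu>)
          = (\<integral>\<^sup>+ x. (\<Sum>i. emeasure (walk_law M X x) (F i)) \<partial>\<mu>)"
        using F meas by (intro nn_integral_suminf[symmetric]) auto
      also have "\<dots> = (\<integral>\<^sup>+ x. emeasure (walk_law M X x) (\<Union>i. F i) \<partial>\<mu>)"
        using F by (intro nn_integral_cong suminf_emeasure) (auto simp: walk_law_def)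
      finally show "(\<Sum>i. \<integral>\<^sup>+ x. emeasure (walk_law M X x) (F i) \<partial>\<mu>)
          = (\<integral>\<^sup>+ x. emeasure (walk_law M X x) (\<Union>i. F i) \<partial>\<mu>)" .
    qed
  qed
qed

lemma up_time_measurable: "(\<lambda>s. up_time s n) \<in> path_space \<rightarrow>\<^sub>M count_space UNIV"
proof (induction n)
  case (Suc n)
  note Suc[measurable]
  show ?case unfolding up_time.simps Inf_nat_def by measurable
qed simp

lemma down_time_measurable: "(\<lambda>s. down_time s n) \<in> path_space \<rightarrow>\<^sub>M count_space UNIV"
proof (induction n)
  case (Suc n)
  note Suc[measurable]
  show ?case unfolding down_time.simps Inf_nat_def by measurable
qed simp

lemma crossing_measurable:
  "overshoot_up n \<in> borel_measurable path_space"
  "undershoot_up n \<in> borel_measurable path_space"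
  "overshoot_down n \<in> borel_measurable path_space"
  "undershoot_down n \<in> borel_measurable path_space"
proof -
  have eval: "(\<lambda>s. s (f s)) \<in> borel_measurable path_space"
    if "f \<in> path_space \<rightarrow>\<^sub>M count_space UNIV" for f :: "(nat \<Rightarrow> real) \<Rightarrow> nat"
    by (rule measurable_compose_countable[OF _ that]) measurable
  note [measurable] = up_time_measurable down_time_measurable
  show "overshoot_up n \<in> borel_measurable path_space"
    "undershoot_up n \<in> borel_measurable path_space"
    "overshoot_down n \<in> borel_measurable path_space"
    "undershoot_down n \<in> borel_measurable path_space"
    unfolding overshoot_up_def[abs_def] undershoot_up_def[abs_def]
      overshoot_down_def[abs_def] undershoot_down_def[abs_def]
    by (rule eval, measurable)+
qed

end

theory Submission
  imports Defs
begin

text \<open>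
  Let \<open>L\<close> be the Haar measure on the lattice, \<open>B\<close> and \<open>A\<close> the two half-lines, and start the walk
  from \<open>L\<close> with the distribution of the increments as its first step. Up to the constant, the initial
  measure of the theorem is the law of the end point of a crossing from \<open>B\<close> to \<open>A\<close> in the
  first step. Paths that cross in the first step and make their \<open>n\<close>-th further crossing in
  step \<open>k\<close> are turned by the reversal \<open>s j \<mapsto> - s (Suc k - j)\<close>, which preserves the
  law of the walk started from \<open>L\<close>, into paths with the same property for crossings from \<open>- A\<close>
  to \<open>- B\<close>. Summing over \<open>k\<close>, the condition on the future disappears, since an oscillating walk
  almost surely crosses infinitely often; what remains is the first step alone, whose two end
  points have explicit laws.
\<close>

subsection \<open>Crossings of a path\<close>

text \<open>The index \<open>j\<close> names the step from time \<open>j\<close> to time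
  \<open>j + 1\<close>, so that time reversal acts on steps by \<open>j \<mapsto> k - j\<close>. By
  contrast, \<open>crossing_time\<close> records the time at which a crossing ends.\<close>

definition crosses :: "real set \<Rightarrow> real set \<Rightarrow> (nat \<Rightarrow> real) \<Rightarrow> nat \<Rightarrow> bool" where
  "crosses B A s j \<longleftrightarrow> s j \<in> B \<and> s (Suc j) \<in> A"

text \<open>Common form of \<open>up_time\<close> and \<open>down_time\<close>, which lets one
  argument serve both directions. Since \<open>k\<close> exceeds an earlier time it is positive, so
  \<open>k - 1\<close> is a true predecessor.\<close>

primrec crossing_time :: "real set \<Rightarrow> real set \<Rightarrow> (nat \<Rightarrow> real) \<Rightarrow> nat \<Rightarrow> nat" where
  "crossing_time B A s 0 = 0"
| "crossing_time B A s (Suc n) =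
     Inf {k. k > crossing_time B A s n \<and> s (k - 1) \<in> B \<and> s k \<in> A}"

lemma up_time_eq_crossing_time: "up_time s n = crossing_time {..<0} {0..} s n"
  by (induction n) auto

lemma down_time_eq_crossing_time: "down_time s n = crossing_time {0..} {..<0} s n"
  by (induction n) auto

lemma crossing_time_measurable [measurable]:
  assumes [measurable]: "A \<in> sets borel" "B \<in> sets borel"
  shows "(\<lambda>s. crossing_time B A s n) \<in> path_space \<rightarrow>\<^sub>M count_space UNIV"
proof (induction n)
  case (Suc n)
  note Suc[measurable]
  show ?case unfolding crossing_time.simps Inf_nat_def by measurable
qed simp

text \<open>\<open>cycle B A s n k\<close>: a crossing takes place in step 0 of the path, and its
  \<open>n\<close>-th successor takes place in step \<open>k\<close>. This event is preserved by reversing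
  the path in time.\<close>

definition cycle :: "real set \<Rightarrow> real set \<Rightarrow> (nat \<Rightarrow> real) \<Rightarrow> nat \<Rightarrow> nat \<Rightarrow> bool" where
  "cycle B A s n k \<longleftrightarrow>
     crosses B A s 0 \<and> crosses B A s k \<and> card {j. j \<le> k \<and> crosses B A s j} = Suc n"

text \<open>Step \<open>j\<close> of \<open>r\<close> is step \<open>k - j\<close> of
  \<open>s\<close>, traversed backwards and reflected. Hence the roles of \<open>A\<close> and
  \<open>B\<close> are exchanged, steps 0 and \<open>k\<close> change places, and the number of
  crossings is the same.\<close>

lemma cycle_reverse:
  assumes "\<And>j. j \<le> Suc k \<Longrightarrow> r j = - s (Suc k - j)"
  shows "cycle B A s n k \<longleftrightarrow> cycle (uminus ` A) (uminus ` B) r n k"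
proof -
  have rev: "crosses (uminus ` A) (uminus ` B) r j \<longleftrightarrow> crosses B A s (k - j)" if "j \<le> k" for j
    using that by (auto simp: crosses_def assms Suc_diff_le)
  have "bij_betw (\<lambda>j. k - j) {j. j \<le> k \<and> crosses (uminus ` A) (uminus ` B) r j}
      {j. j \<le> k \<and> crosses B A s j}"
    by (rule bij_betw_byWitness[where f' = "\<lambda>j. k - j"]) (auto simp: rev)
  then show ?thesis
    unfolding cycle_def by (auto dest!: bij_betw_same_card simp: rev)
qed

text \<open>The crossing steps form an infinite set, and \<open>k\<close> must be its element number
  \<open>n\<close> in increasing order, counted from 0; the element number 0 is step 0.\<close>

lemma cycle_ex1:
  assumes "crosses B A s 0" and inf: "\<exists>\<^sub>\<infinity>j. crosses B A s j"
  shows "\<exists>!k. cycle B A s n k"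
proof -
  let ?C = "{j. crosses B A s j}"
  have C: "infinite ?C" using inf by (simp add: INFM_iff_infinite)
  have le: "{j. j \<le> enumerate ?C n \<and> crosses B A s j} = enumerate ?C ` {..n}" for n
  proof (intro equalityI subsetI)
    fix j assume j: "j \<in> {j. j \<le> enumerate ?C n \<and> crosses B A s j}"
    then obtain m where "j = enumerate ?C m"
      using enumerate_Ex[of ?C j] C by auto
    with j C show "j \<in> enumerate ?C ` {..n}" by (auto simp: enumerate_mono_le_iff)
  next
    fix j assume "j \<in> enumerate ?C ` {..n}"
    then show "j \<in> {j. j \<le> enumerate ?C n \<and> crosses B A s j}"
      using enumerate_in_set[OF C] C by (auto simp: enumerate_mono_le_iff)
  qed
  have card: "card {j. j \<le> enumerate ?C n \<and> crosses B A s j} = Suc n" for n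
    unfolding le using inj_enumerate[OF C] by (simp add: card_image inj_on_subset)
  show ?thesis
  proof (rule ex1I[of _ "enumerate ?C n"])
    show "cycle B A s n (enumerate ?C n)"
      unfolding cycle_def using assms(1) card enumerate_in_set[OF C] by auto
    fix k assume "cycle B A s n k"
    then show "k = enumerate ?C n"
      unfolding cycle_def using card enumerate_Ex[of ?C k] C by fastforce
  qed
qed

text \<open>Deleting the first step shifts times by one, so a crossing that ends at time
  \<open>k\<close> of the shifted path is a crossing in step \<open>k\<close> of \<open>s\<close>.
  Each further crossing time adds exactly one crossing to the count, because none lies strictly
  between consecutive ones.\<close>

lemma cycle_crossing_time:
  assumes "crosses B A s 0" and inf: "\<exists>\<^sub>\<infinity>j. crosses B A s j"
  shows "cycle B A s n (crossing_time B A (\<lambda>j. s (Suc j)) n)"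
proof (induction n)
  case 0
  have "{j. j = 0 \<and> crosses B A s j} = {0}" using assms by auto
  then show ?case using assms by (simp add: cycle_def)
next
  case (Suc n)
  let ?T = "crossing_time B A (\<lambda>j. s (Suc j))"
  let ?K = "{k. k > ?T n \<and> s (Suc (k - 1)) \<in> B \<and> s (Suc k) \<in> A}"
  have K: "?K = {k. k > ?T n \<and> crosses B A s k}"
    by (auto simp: crosses_def)
  obtain k where "k > ?T n" "crosses B A s k"
    using inf by (auto simp: INFM_nat)
  then have "?K \<noteq> {}" unfolding K by auto
  then have "?T (Suc n) \<in> ?K"
    unfolding crossing_time.simps by (rule Inf_nat_def1)
  then have 1: "?T (Suc n) > ?T n" "crosses B A s (?T (Suc n))"
    unfolding K by auto
  have 2: "\<not> crosses B A s j" if "?T n < j" "j < ?T (Suc n)" for j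
  proof
    assume "crosses B A s j"
    then have "j \<in> ?K" unfolding K using that by auto
    then have "?T (Suc n) \<le> j" unfolding crossing_time.simps by (rule wellorder_Inf_le1)
    with that show False by simp
  qed
  have "{j. j \<le> ?T (Suc n) \<and> crosses B A s j}
      = insert (?T (Suc n)) {j. j \<le> ?T n \<and> crosses B A s j}"
  proof (intro equalityI subsetI)
    fix j assume "j \<in> {j. j \<le> ?T (Suc n) \<and> crosses B A s j}"
    with 2[of j] show "j \<in> insert (?T (Suc n)) {j. j \<le> ?T n \<and> crosses B A s j}"
      by (cases "j \<le> ?T n"; cases "j = ?T (Suc n)") auto
  next
    fix j assume "j \<in> insert (?T (Suc n)) {j. j \<le> ?T n \<and> crosses B A s j}"
    with 1 show "j \<in> {j. j \<le> ?T (Suc n) \<and> crosses B A s j}"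
      by (auto simp del: crossing_time.simps)
  qed
  then have "card {j. j \<le> ?T (Suc n) \<and> crosses B A s j} = Suc (Suc n)"
    using 1 Suc by (simp add: cycle_def del: crossing_time.simps)
  with 1 Suc show ?case by (simp add: cycle_def del: crossing_time.simps)
qed

text \<open>For \<open>k = 0\<close> at most one step is counted. This turns the truncated
  \<open>k - 1\<close> in the undershoot into a true predecessor.\<close>

lemma cycle_pos: "cycle B A s n k \<Longrightarrow> n \<ge> 1 \<Longrightarrow> k \<ge> 1"
proof (rule ccontr)
  assume *: "cycle B A s n k" "n \<ge> 1" "\<not> k \<ge> 1"
  then have "card {j. j \<le> k \<and> crosses B A s j} \<le> card {0::nat}"
    by (intro card_mono) auto
  with * show False by (simp add: cycle_def)
qed

lemma suminf_cycle:
  fixes f :: "nat \<Rightarrow> ennreal"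
  assumes "cycle B A s n k" "\<exists>\<^sub>\<infinity>j. crosses B A s j"
  shows "(\<Sum>i. indicator {s. cycle B A s n i} s * f i) = f k"
proof -
  have "crosses B A s 0" using assms(1) by (simp add: cycle_def)
  then have "cycle B A s n i \<Longrightarrow> i = k" for i
    using cycle_ex1[OF _ assms(2), of n] assms(1) by blast
  then have "(\<Sum>i. indicator {s. cycle B A s n i} s * f i)
      = (\<Sum>i\<in>{k}. indicator {s. cycle B A s n i} s * f i)"
    by (intro suminf_finite) (auto simp: indicator_def)
  with assms(1) show ?thesis by simp
qed

text \<open>For fixed \<open>n\<close> the events \<open>cycle B A s n i\<close> partition the event
  of a crossing in step 0. Summing a weight that does not depend on \<open>i\<close> therefore
  erases the condition on the future.\<close>

lemma suminf_cycle_const: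
  fixes c :: ennreal
  assumes "\<exists>\<^sub>\<infinity>j. crosses B A s j"
  shows "(\<Sum>i. indicator {s. cycle B A s n i} s * c) = indicator B (s 0) * indicator A (s (Suc 0)) * c"
proof (cases "crosses B A s 0")
  case True
  then obtain k where k: "cycle B A s n k"
    using cycle_ex1[OF _ assms] by blast
  have "s 0 \<in> B" "s (Suc 0) \<in> A" using True by (auto simp: crosses_def)
  then show ?thesis using suminf_cycle[OF k assms, of "\<lambda>_. c"] by simp
next
  case False
  then have "\<not> cycle B A s n k" for k by (simp add: cycle_def)
  then show ?thesis using False by (auto simp: crosses_def indicator_def)
qed

text \<open>Both sets contain a half-line, so the path visits each of them at arbitrarily late
  times, and between a visit to \<open>B\<close> and a later visit to \<open>A\<close> there is a
  crossing. The two alternatives cover up-crossings and down-crossings, with no condition at the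
  boundary point \<open>c\<close>.\<close>

lemma oscillating_crosses:
  assumes "oscillating s" and AB: "A \<union> B = UNIV"
    and "(\<exists>c. {..<c} \<subseteq> B \<and> {c<..} \<subseteq> A) \<or> (\<exists>c. {c<..} \<subseteq> B \<and> {..<c} \<subseteq> A)"
  shows "\<exists>\<^sub>\<infinity>j. crosses B A s j"
proof -
  have below: "\<exists>n\<ge>m. s n < c" for m c
  proof (rule ccontr)
    assume "\<not> ?thesis"
    then have "ereal c \<le> liminf (\<lambda>n. ereal (s n))"
      by (intro Liminf_bounded) (auto simp: eventually_sequentially not_less)
    then show False using assms(1) by (simp add: oscillating_def)
  qed
  have above: "\<exists>n\<ge>m. c < s n" for m c
  proof (rule ccontr)
    assume "\<not> ?thesis"
    then have "limsup (\<lambda>n. ereal (s n)) \<le> ereal c"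
      by (intro Limsup_bounded) (auto simp: eventually_sequentially not_less)
    then show False using assms(1) by (simp add: oscillating_def)
  qed
  have B: "\<exists>n\<ge>m. s n \<in> B" and A: "\<exists>n\<ge>m. s n \<in> A" for m
    using assms(3) below[of m] above[of m] by blast+
  show ?thesis
    unfolding INFM_nat_le
  proof
    fix m
    obtain a where a: "a \<ge> m" "s a \<in> B" using B by auto
    \<comment> \<open>First visit to \<open>A\<close> after time \<open>a\<close>: the point before
      it is either the point at time \<open>a\<close> or lies outside \<open>A\<close>, and so
      belongs to \<open>B\<close>.\<close>
    define b where "b = (LEAST b. b \<ge> Suc a \<and> s b \<in> A)"
    have b: "b \<ge> Suc a \<and> s b \<in> A"
      unfolding b_def by (rule LeastI_ex) (use A in auto)
    have "s (b - 1) \<in> B"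
    proof (cases "b - 1 = a")
      case False
      then have "b - 1 \<ge> Suc a" "b - 1 < b" using b by auto
      then have "s (b - 1) \<notin> A"
        unfolding b_def using not_less_Least by blast
      with AB show ?thesis by auto
    qed (use a in simp)
    with a b show "\<exists>j\<ge>m. crosses B A s j"
      by (intro exI[of _ "b - 1"]) (auto simp: crosses_def)
  qed
qed

subsection \<open>Time reversal of the stationary walk\<close>

text \<open>The walk as a function of its start and its increments, with increments numbered from 0;
  it agrees with \<open>walk\<close> for \<open>w n = X (Suc n) \<omega>\<close>.\<close>

definition path :: "real \<Rightarrow> (nat \<Rightarrow> real) \<Rightarrow> nat \<Rightarrow> real" where
  "path u w n = u + (\<Sum>i<n. w i)"

lemma path_0 [simp]: "path u w 0 = u"
  by (simp add: path_def)

lemma path_Suc: "path u w (Suc n) = path u w n + w n"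
  by (simp add: path_def)

lemma path_case_nat: "path u (case_nat t w) (Suc n) = path (u + t) w n"
  by (simp add: path_def sum.lessThan_Suc_shift del: sum.lessThan_Suc)

text \<open>Starting at minus the end point and using the first \<open>k\<close> increments in the
  opposite order retraces the path upside down. Increments from index \<open>k\<close> on stay in
  place, which makes the reindexing a bijection of the natural numbers.\<close>

lemma path_reversed:
  assumes "j \<le> k"
  shows "path (- path u w k) (\<lambda>i. w (if i < k then k - 1 - i else i)) j = - path u w (k - j)"
  using assms
proof (induction j)
  case (Suc j)
  have "k - j = Suc (k - Suc j)" "k - 1 - j = k - Suc j" using Suc.prems by auto
  with Suc show ?case by (simp add: path_Suc)
qed simp

lemma path_measurable [measurable]:
  "(\<lambda>(u, w). path u w) \<in> borel \<Otimes>\<^sub>M path_space \<rightarrow>\<^sub>M path_space"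
  unfolding path_def split_def by (rule measurable_PiM_single') auto

lemma path_measurable_component:
  assumes [measurable]: "f \<in> borel_measurable M" "g \<in> M \<rightarrow>\<^sub>M path_space"
  shows "(\<lambda>x. path (f x) (g x)) \<in> M \<rightarrow>\<^sub>M path_space"
  using path_measurable by measurable

lemma path_measurable_snd [measurable]: "path x \<in> path_space \<rightarrow>\<^sub>M path_space"
  by (rule path_measurable_component[of "\<lambda>_. x" _ "\<lambda>w. w"]) (rule measurable_const, simp_all)

lemma path_eval_measurable:
  assumes [measurable]: "f \<in> borel_measurable M" "g \<in> M \<rightarrow>\<^sub>M path_space"
  shows "(\<lambda>x. path (f x) (g x) n) \<in> borel_measurable M"
  unfolding path_def by measurable

lemma path_Suc_measurable:
  assumes [measurable]: "f \<in> borel_measurable M" "g \<in> M \<rightarrow>\<^sub>M path_space"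
  shows "(\<lambda>x j. path (f x) (g x) (Suc j)) \<in> M \<rightarrow>\<^sub>M path_space"
  unfolding path_def by (rule measurable_PiM_single') auto

lemma cycle_measurable [measurable]:
  assumes [measurable]: "A \<in> sets borel" "B \<in> sets borel"
  shows "Measurable.pred path_space (\<lambda>s. cycle B A s n k)"
  unfolding cycle_def crosses_def by measurable

text \<open>\<open>N\<close> is the law of one increment, \<open>S\<close> the law of the i.i.d.
  increments, and \<open>L\<close> a possibly infinite initial measure. Translation invariance is
  asked for almost every increment only, since the increments lie in the lattice only almost
  surely.\<close>

locale reversible_walk = sequence_space N for N :: "real measure" +
  fixes L :: "real measure"
  assumes sets_N [measurable_cong, simp]: "sets N = sets borel"
    and sets_L [measurable_cong, simp]: "sets L = sets borel"
    and sigma_finite_L: "sigma_finite_measure L"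
    and L_translate: "AE t in N. distr L borel ((+) t) = L"
    and L_minus: "distr L borel uminus = L"
begin

sublocale L: sigma_finite_measure L
  by (rule sigma_finite_L)

sublocale pair_LS: pair_sigma_finite L S
  by unfold_locales

sublocale pair_LN: pair_sigma_finite L N
  by unfold_locales

lemma space_N [simp]: "space N = UNIV"
  using sets_eq_imp_space_eq[OF sets_N] by simp

lemma space_L [simp]: "space L = UNIV"
  using sets_eq_imp_space_eq[OF sets_L] by simp

lemma sets_S [measurable_cong, simp]: "sets S = sets path_space"
  by (rule sets_PiM_cong) auto

lemma nn_integral_L_minus:
  "f \<in> borel_measurable borel \<Longrightarrow> (\<integral>\<^sup>+x. f (- x) \<partial>L) = (\<integral>\<^sup>+x. f x \<partial>L)"
  by (subst (2) L_minus[symmetric]) (simp add: nn_integral_distr)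

lemma nn_integral_L_translate:
  assumes "distr L borel ((+) t) = L" "f \<in> borel_measurable borel"
  shows "(\<integral>\<^sup>+x. f (t + x) \<partial>L) = (\<integral>\<^sup>+x. f x \<partial>L)"
  using assms(2) by (subst (2) assms(1)[symmetric]) (simp add: nn_integral_distr)

text \<open>Translation by a partial sum is a composition of translations by the single increments.
  One null set of increments serves all \<open>k\<close>.\<close>

lemma L_translate_sum:
  "AE w in S. \<forall>k. distr L borel ((+) (\<Sum>i<k. w i)) = L"
proof -
  have "AE w in S. \<forall>i. distr L borel ((+) (w i)) = L"
    unfolding AE_all_countable using AE_component[OF _ L_translate] by auto
  then show ?thesis
  proof eventually_elim
    case (elim w)
    show ?case
    proof
      fix k
      show "distr L borel ((+) (\<Sum>i<k. w i)) = L"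
      proof (induction k)
        case 0
        show ?case by (simp add: distr_id2)
      next
        case (Suc k)
        have "(+) (\<Sum>i<Suc k. w i) = (+) (\<Sum>i<k. w i) \<circ> (+) (w k)"
          by (simp add: fun_eq_iff)
        then have "distr L borel ((+) (\<Sum>i<Suc k. w i))
            = distr (distr L borel ((+) (w k))) borel ((+) (\<Sum>i<k. w i))"
          by (simp only:) (subst distr_distr, simp_all)
        with Suc elim show ?case by simp
      qed
    qed
  qed
qed

section \<open>Integrals over the i.i.d. increments\<close>

lemma nn_integral_S_case_nat:
  assumes [measurable]: "f \<in> borel_measurable path_space"
  shows "(\<integral>\<^sup>+w. f w \<partial>S) = (\<integral>\<^sup>+t. \<integral>\<^sup>+w. f (case_nat t w) \<partial>S \<partial>N)"
proof -
  have [measurable]: "(\<lambda>(t, w). case_nat t w) \<in> N \<Otimes>\<^sub>M S \<rightarrow>\<^sub>M S"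
    by (simp add: measurable_case_nat')
  have "(\<integral>\<^sup>+w. f w \<partial>S) = (\<integral>\<^sup>+p. f ((\<lambda>(t, w). case_nat t w) p) \<partial>(N \<Otimes>\<^sub>M S))"
    by (subst PiM_iter[symmetric]) (simp add: nn_integral_distr)
  also have "\<dots> = (\<integral>\<^sup>+t. \<integral>\<^sup>+w. f (case_nat t w) \<partial>S \<partial>N)"
    by (subst P.nn_integral_fst[symmetric]) simp_all
  finally show ?thesis .
qed

lemma nn_integral_S_reindex:
  assumes "bij \<phi>" and [measurable]: "f \<in> borel_measurable path_space"
  shows "(\<integral>\<^sup>+w. f (\<lambda>i. w (\<phi> i)) \<partial>S) = (\<integral>\<^sup>+w. f w \<partial>S)"
proof -
  have "distr S S (\<lambda>w n. w (\<phi> n)) = S"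
    using distr_PiM_reindex[of UNIV "\<lambda>_. N" \<phi> UNIV] assms(1)
    by (simp add: bij_def M.prob_space_axioms restrict_def)
  moreover have "(\<lambda>w n. w (\<phi> n)) \<in> S \<rightarrow>\<^sub>M S"
    by (rule measurable_PiM_single') (auto simp: space_PiM)
  moreover have "f \<in> borel_measurable S"
    by measurable
  ultimately show ?thesis
    by (metis nn_integral_distr)
qed

text \<open>By Fubini and the substitution \<open>x = u + t\<close>, which preserves
  \<open>L\<close>, the factor \<open>indicator A x * emeasure N {t. x - t \<in> B}\<close> is the
  \<open>L\<close>-density of the end point of a first step from \<open>B\<close> to
  \<open>A\<close>. Integrating against it means prepending such a step to the path.\<close>

lemma nn_integral_prepend_step:
  assumes [measurable]: "A \<in> sets borel" "B \<in> sets borel" "g \<in> borel_measurable path_space"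
  shows "(\<integral>\<^sup>+x. indicator A x * emeasure N {t. x - t \<in> B} * (\<integral>\<^sup>+w. g (path x w) \<partial>S) \<partial>L)
    = (\<integral>\<^sup>+u. \<integral>\<^sup>+w. indicator B u * indicator A (path u w (Suc 0)) * g (\<lambda>j. path u w (Suc j)) \<partial>S \<partial>L)"
    (is "?l = ?r")
proof -
  note path_measurable_component[measurable] path_eval_measurable[measurable] path_Suc_measurable[measurable]
  have "?r = (\<integral>\<^sup>+u. \<integral>\<^sup>+t. \<integral>\<^sup>+w. indicator B u * indicator A (u + t) * g (path (u + t) w) \<partial>S \<partial>N \<partial>L)"
    by (subst nn_integral_S_case_nat) (simp_all add: path_case_nat)
  also have "\<dots> = (\<integral>\<^sup>+t. \<integral>\<^sup>+u. \<integral>\<^sup>+w. indicator B u * indicator A (u + t) * g (path (u + t) w) \<partial>S \<partial>L \<partial>N)"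
    by (rule pair_LN.Fubini'[symmetric]) measurable
  also have "\<dots> = (\<integral>\<^sup>+t. \<integral>\<^sup>+x. \<integral>\<^sup>+w. indicator B (x - t) * indicator A x * g (path x w) \<partial>S \<partial>L \<partial>N)"
  proof (intro nn_integral_cong_AE, use L_translate in eventually_elim)
    case (elim t)
    show ?case
      using nn_integral_L_translate[OF elim,
          of "\<lambda>x. \<integral>\<^sup>+w. indicator B (x - t) * indicator A x * g (path x w) \<partial>S"]
      by (simp add: add.commute)
  qed
  also have "\<dots> = (\<integral>\<^sup>+x. \<integral>\<^sup>+t. \<integral>\<^sup>+w. indicator B (x - t) * indicator A x * g (path x w) \<partial>S \<partial>N \<partial>L)"
    by (rule pair_LN.Fubini') measurable
  also have "\<dots> = ?l"
  proof (rule nn_integral_cong)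
    fix x
    have [measurable]: "(\<lambda>w. g (path x w)) \<in> borel_measurable S"
      by measurable
    have "(\<integral>\<^sup>+t. \<integral>\<^sup>+w. indicator B (x - t) * indicator A x * g (path x w) \<partial>S \<partial>N)
       = (\<integral>\<^sup>+t. indicator {t. x - t \<in> B} t * (indicator A x * (\<integral>\<^sup>+w. g (path x w) \<partial>S)) \<partial>N)"
      by (intro nn_integral_cong, subst nn_integral_cmult) (simp_all add: mult_ac indicator_def)
    also have "\<dots> = emeasure N {t. x - t \<in> B} * (indicator A x * (\<integral>\<^sup>+w. g (path x w) \<partial>S))"
      by (subst nn_integral_multc) simp_all
    finally show "(\<integral>\<^sup>+t. \<integral>\<^sup>+w. indicator B (x - t) * indicator A x * g (path x w) \<partial>S \<partial>N)
      = indicator A x * emeasure N {t. x - t \<in> B} * (\<integral>\<^sup>+w. g (path x w) \<partial>S)"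
      by (simp add: mult_ac)
  qed
  finally show ?thesis ..
qed

text \<open>For fixed increments, \<open>u \<mapsto> - path u w k\<close> is a translation followed
  by a reflection and preserves \<open>L\<close>; permuting the increments preserves
  \<open>S\<close>. By \<open>path_reversed\<close>, the two together reverse the first
  \<open>k\<close> steps in time.\<close>

lemma nn_integral_reverse:
  assumes [measurable]: "g \<in> borel_measurable path_space"
  shows "(\<integral>\<^sup>+u. \<integral>\<^sup>+w. g (path u w) \<partial>S \<partial>L)
    = (\<integral>\<^sup>+u. \<integral>\<^sup>+w. g (path (- path u w k) (\<lambda>i. w (if i < k then k - 1 - i else i))) \<partial>S \<partial>L)"
proof -
  note path_measurable_component[measurable]
  let ?\<phi> = "\<lambda>i. if i < k then k - 1 - i else i"
  have [measurable]: "(\<lambda>p i. snd p (?\<phi> i)) \<in> L \<Otimes>\<^sub>M S \<rightarrow>\<^sub>M path_space"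
    by (rule measurable_PiM_single') auto
  have bij: "bij ?\<phi>"
    by (rule bij_betw_byWitness[where f' = ?\<phi>]) auto
  have sum: "(\<Sum>i<k. w (?\<phi> i)) = (\<Sum>i<k. w i)" for w :: "nat \<Rightarrow> real"
    by (subst sum.nat_diff_reindex[symmetric]) (auto intro!: sum.cong)
  \<comment> \<open>The end point after \<open>k\<close> steps does not depend on the order of the
    first \<open>k\<close> increments, so the new start \<open>- path u w k\<close> is unaffected by
    the reindexing.\<close>
  have path_k: "path u (\<lambda>i. w (?\<phi> i)) k = path u w k" for u w
    by (simp only: path_def sum)
  have "(\<integral>\<^sup>+u. \<integral>\<^sup>+w. g (path u w) \<partial>S \<partial>L) = (\<integral>\<^sup>+w. \<integral>\<^sup>+u. g (path u w) \<partial>L \<partial>S)"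
    by (rule pair_LS.Fubini'[symmetric]) measurable
  also have "\<dots> = (\<integral>\<^sup>+w. \<integral>\<^sup>+u. g (path (- path u w k) w) \<partial>L \<partial>S)"
  proof (intro nn_integral_cong_AE, use L_translate_sum in eventually_elim)
    case (elim w)
    have g: "(\<lambda>u. g (path (f u) w)) \<in> borel_measurable borel"
      if [measurable]: "f \<in> borel_measurable borel" for f :: "real \<Rightarrow> real"
      by measurable (simp add: space_PiM)
    have "(\<integral>\<^sup>+u. g (path (- path u w k) w) \<partial>L) = (\<integral>\<^sup>+u. g (path (- u) w) \<partial>L)"
      using nn_integral_L_translate[OF spec[OF elim, of k], of "\<lambda>u. g (path (- u) w)"]
        g[of uminus]
      by (simp add: path_def[of _ _ k] add.commute)
    also have "\<dots> = (\<integral>\<^sup>+u. g (path u w) \<partial>L)"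
      by (rule nn_integral_L_minus) (rule g, simp)
    finally show ?case ..
  qed
  also have "\<dots> = (\<integral>\<^sup>+w. \<integral>\<^sup>+u. g (path (- path u w k) (\<lambda>i. w (?\<phi> i))) \<partial>L \<partial>S)"
    by (subst nn_integral_S_reindex[OF bij, symmetric]) (simp_all only: path_k, measurable)
  also have "\<dots> = (\<integral>\<^sup>+u. \<integral>\<^sup>+w. g (path (- path u w k) (\<lambda>i. w (?\<phi> i))) \<partial>S \<partial>L)"
    by (rule pair_LS.Fubini') measurable
  finally show ?thesis .
qed

text \<open>The two end points of the \<open>n\<close>-th crossing after a prepended one have the
  same joint law as those of the prepended crossing itself. Both laws may be infinite, so this is an
  equality of integrals of nonnegative functions.\<close>

lemma nn_integral_crossing_pair:
  assumes [measurable]: "A \<in> sets borel" "B \<in> sets borel"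
    and G [measurable]: "(\<lambda>(a, b). G a b) \<in> borel_measurable (borel \<Otimes>\<^sub>M borel)"
    and inf: "AE w in S. \<forall>x. \<exists>\<^sub>\<infinity>j. crosses B A (path x w) j"
    and inf_rev: "AE w in S. \<forall>x. \<exists>\<^sub>\<infinity>j. crosses (uminus ` A) (uminus ` B) (path x w) j"
    and n: "n \<ge> 1"
  defines "T \<equiv> \<lambda>s. crossing_time B A s n"
  shows "(\<integral>\<^sup>+x. indicator A x * emeasure N {t. x - t \<in> B} *
        (\<integral>\<^sup>+w. G (path x w (T (path x w) - 1)) (path x w (T (path x w))) \<partial>S) \<partial>L)
    = (\<integral>\<^sup>+u. \<integral>\<^sup>+w. indicator B u * indicator A (path u w (Suc 0)) * G u (path u w (Suc 0)) \<partial>S \<partial>L)"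
    (is "?l = ?r")
proof -
  note path_measurable_component[measurable] path_eval_measurable[measurable]
    path_Suc_measurable[measurable]
  have uminus_image: "uminus ` C = uminus -` C" for C :: "real set"
    by (auto simp: image_iff) (metis minus_minus)
  have neg: "uminus ` C \<in> sets borel" if "C \<in> sets borel" for C :: "real set"
  proof -
    have "(uminus :: real \<Rightarrow> real) \<in> borel_measurable borel" by measurable
    from measurable_sets[OF this that] show ?thesis by (simp add: uminus_image)
  qed
  have [measurable]: "uminus ` A \<in> sets borel" "uminus ` B \<in> sets borel"
    using neg by simp_all
  have T [measurable]: "T \<in> path_space \<rightarrow>\<^sub>M count_space UNIV"
    unfolding T_def by measurable
  have [measurable]: "(\<lambda>s. s (T s)) \<in> borel_measurable path_space"
    "(\<lambda>s. s (T s - 1)) \<in> borel_measurable path_space"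
    by measurable
  have G_T [measurable]: "(\<lambda>s. G (s (T s - 1)) (s (T s))) \<in> borel_measurable path_space"
  proof -
    have "(\<lambda>s. (s (T s - 1), s (T s))) \<in> path_space \<rightarrow>\<^sub>M borel \<Otimes>\<^sub>M borel"
      by measurable
    from measurable_compose[OF this G] show ?thesis by (simp only: prod.case)
  qed
  let ?g = "\<lambda>k s. indicator {s. cycle B A s n k} s * G (s k) (s (Suc k))"
  from nn_integral_prepend_step[OF assms(1,2) G_T]
  have "?l = (\<integral>\<^sup>+u. \<integral>\<^sup>+w. indicator B u * indicator A (path u w (Suc 0)) *
      G (path u w (Suc (T (\<lambda>j. path u w (Suc j)) - 1))) (path u w (Suc (T (\<lambda>j. path u w (Suc j))))) \<partial>S \<partial>L)"
    by (simp only: path_0)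
  \<comment> \<open>Split according to the step \<open>k\<close> of the \<open>n\<close>-th further
    crossing; almost surely exactly one summand is nonzero on paths that cross in step 0. Since
    \<open>n \<ge> 1\<close>, this step is not step 0 and the undershoot is indeed the value at time
    \<open>k\<close>.\<close>
  also have "\<dots> = (\<integral>\<^sup>+u. \<integral>\<^sup>+w. (\<Sum>k. ?g k (path u w)) \<partial>S \<partial>L)"
  proof (rule nn_integral_cong, rule nn_integral_cong_AE, use inf in eventually_elim)
    case (elim u w)
    let ?s = "path u w"
    have i: "\<exists>\<^sub>\<infinity>j. crosses B A ?s j" using elim by blast
    show ?case
    proof (cases "crosses B A ?s 0")
      case True
      let ?k = "T (\<lambda>j. ?s (Suc j))"
      have k: "cycle B A ?s n ?k"
        unfolding T_def by (rule cycle_crossing_time[OF True i])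
      from cycle_pos[OF this n] have "Suc (?k - 1) = ?k" by simp
      with True show ?thesis
        unfolding suminf_cycle[OF k i] by (auto simp: crosses_def)
    next
      case False
      then have "\<not> cycle B A ?s n k" for k by (simp add: cycle_def)
      then show ?thesis using False by (auto simp: crosses_def indicator_def)
    qed
  qed
  also have "\<dots> = (\<Sum>k. \<integral>\<^sup>+u. \<integral>\<^sup>+w. ?g k (path u w) \<partial>S \<partial>L)"
    by (simp add: nn_integral_suminf)
  \<comment> \<open>Reversing \<open>Suc k\<close> steps moves the crossing in step \<open>k\<close>
    to step 0. The argument of \<open>G\<close> then depends on the first step alone, no longer on
    \<open>k\<close>.\<close>
  also have "\<dots> = (\<Sum>k. \<integral>\<^sup>+u. \<integral>\<^sup>+w. indicator {s. cycle (uminus ` A) (uminus ` B) s n k} (path u w)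
      * G (- path u w (Suc 0)) (- u) \<partial>S \<partial>L)"
  proof (rule suminf_cong)
    fix k
    have "(\<integral>\<^sup>+u. \<integral>\<^sup>+w. ?g k (path u w) \<partial>S \<partial>L) = (\<integral>\<^sup>+u. \<integral>\<^sup>+w.
        ?g k (path (- path u w (Suc k)) (\<lambda>i. w (if i < Suc k then Suc k - 1 - i else i))) \<partial>S \<partial>L)"
      by (rule nn_integral_reverse) measurable
    also have "\<dots> = (\<integral>\<^sup>+u. \<integral>\<^sup>+w. indicator {s. cycle (uminus ` A) (uminus ` B) s n k} (path u w)
      * G (- path u w (Suc 0)) (- u) \<partial>S \<partial>L)"
    proof (intro nn_integral_cong)
      fix u w
      let ?r = "path (- path u w (Suc k)) (\<lambda>i. w (if i < Suc k then Suc k - 1 - i else i))"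
      have r: "?r j = - path u w (Suc k - j)" if "j \<le> Suc k" for j
        using that by (rule path_reversed)
      have "cycle B A ?r n k \<longleftrightarrow> cycle (uminus ` A) (uminus ` B) (path u w) n k"
        by (rule cycle_reverse) (subst r, auto)
      then show "?g k ?r = indicator {s. cycle (uminus ` A) (uminus ` B) s n k} (path u w)
          * G (- path u w (Suc 0)) (- u)"
        using r[of k] r[of "Suc k"] by (simp add: indicator_def)
    qed
    finally show "(\<integral>\<^sup>+u. \<integral>\<^sup>+w. ?g k (path u w) \<partial>S \<partial>L) = \<dots>" .
  qed
  also have "\<dots> = (\<integral>\<^sup>+u. \<integral>\<^sup>+w. (\<Sum>k. indicator {s. cycle (uminus ` A) (uminus ` B) s n k} (path u w)
      * G (- path u w (Suc 0)) (- u)) \<partial>S \<partial>L)"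
    by (simp add: nn_integral_suminf del: ennreal_suminf_multc)
  \<comment> \<open>The weight is now constant in \<open>k\<close>, so the sum leaves only the
    requirement that the first step be a crossing from \<open>- A\<close> to
    \<open>- B\<close>.\<close>
  also have "\<dots> = (\<integral>\<^sup>+u. \<integral>\<^sup>+w. indicator (uminus ` A) u * indicator (uminus ` B) (path u w (Suc 0))
      * G (- path u w (Suc 0)) (- u) \<partial>S \<partial>L)"
    by (rule nn_integral_cong, rule nn_integral_cong_AE, use inf_rev in eventually_elim)
      (simp only: suminf_cycle_const path_0)
  also have "\<dots> = ?r"
  proof -
    \<comment> \<open>Reversal of a single step undoes the reflection and restores a crossing from
      \<open>B\<close> to \<open>A\<close>.\<close>
    have "?r = (\<integral>\<^sup>+u. \<integral>\<^sup>+w. (\<lambda>s. indicator B (s 0) * indicator A (s (Suc 0)) * G (s 0) (s (Suc 0)))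
        (path (- path u w (Suc 0)) (\<lambda>i. w (if i < Suc 0 then Suc 0 - 1 - i else i))) \<partial>S \<partial>L)"
      by (subst nn_integral_reverse[symmetric]) simp_all
    also have "\<dots> = (\<integral>\<^sup>+u. \<integral>\<^sup>+w. indicator (uminus ` A) u * indicator (uminus ` B) (path u w (Suc 0))
      * G (- path u w (Suc 0)) (- u) \<partial>S \<partial>L)"
    proof (intro nn_integral_cong)
      fix u w
      let ?r = "path (- path u w (Suc 0)) (\<lambda>i. w (if i < Suc 0 then Suc 0 - 1 - i else i))"
      have r: "?r 0 = - path u w (Suc 0)" "?r (Suc 0) = - u"
        by (subst path_reversed; simp)+
      show "(\<lambda>s. indicator B (s 0) * indicator A (s (Suc 0)) * G (s 0) (s (Suc 0))) ?r
          = indicator (uminus ` A) u * indicator (uminus ` B) (path u w (Suc 0))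
            * G (- path u w (Suc 0)) (- u)"
        unfolding r by (simp add: uminus_image indicator_def)
    qed
    finally show ?thesis ..
  qed
  finally show ?thesis .
qed

text \<open>\<open>R\<close> plays the part of the law of the walk with initial measure
  \<open>\<mu>\<close>, known through its values on measurable sets. A function \<open>G\<close> of
  the second coordinate gives the overshoots, one of the first coordinate the undershoots.\<close>

lemma distr_crossing:
  assumes [measurable]: "A \<in> sets borel" "B \<in> sets borel"
    and inf: "AE w in S. \<forall>x. \<exists>\<^sub>\<infinity>j. crosses B A (path x w) j"
    and inf_rev: "AE w in S. \<forall>x. \<exists>\<^sub>\<infinity>j. crosses (uminus ` A) (uminus ` B) (path x w) j"
    and n: "n \<ge> 1"
    and \<mu>: "\<mu> = density L (\<lambda>x. c * (indicator A x * emeasure N {t. x - t \<in> B}))"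
    and R: "sets R = sets path_space"
      "\<And>E. E \<in> sets path_space \<Longrightarrow> emeasure R E = (\<integral>\<^sup>+x. emeasure (distr S path_space (path x)) E \<partial>\<mu>)"
  shows "distr R borel (\<lambda>s. s (crossing_time B A s n)) = \<mu>"
    and "distr R borel (\<lambda>s. s (crossing_time B A s n - 1))
      = density L (\<lambda>u. c * (indicator B u * emeasure N {t. u + t \<in> A}))"
proof -
  note path_measurable_component[measurable] path_eval_measurable[measurable]
  let ?T = "\<lambda>s. crossing_time B A s n"
  let ?p = "\<lambda>x. indicator A x * emeasure N {t. x - t \<in> B} :: ennreal"
  have f [measurable]: "(\<lambda>s. s (?T s)) \<in> borel_measurable path_space"
    "(\<lambda>s. s (?T s - 1)) \<in> borel_measurable path_space"
    by measurable
  have p [measurable]: "?p \<in> borel_measurable borel"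
    by measurable
  have [measurable]: "(\<lambda>x. c * ?p x) \<in> borel_measurable L"
    unfolding measurable_cong_sets[OF sets_L refl]
    by (rule borel_measurable_times_ennreal[OF borel_measurable_const p])
  have law: "emeasure (distr R borel f) D = c * (\<integral>\<^sup>+x. ?p x * (\<integral>\<^sup>+w. indicator D (f (path x w)) \<partial>S) \<partial>L)"
    if f [measurable]: "f \<in> borel_measurable path_space" and D [measurable]: "D \<in> sets borel" for f :: "(nat \<Rightarrow> real) \<Rightarrow> real" and D
  proof -
    have "(\<lambda>x. \<integral>\<^sup>+w. indicator D (f (path x w)) \<partial>S) \<in> borel_measurable borel"
      by measurable
    from borel_measurable_times_ennreal[OF p this]
    have pI: "(\<lambda>x. ?p x * (\<integral>\<^sup>+w. indicator D (f (path x w)) \<partial>S)) \<in> borel_measurable L"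
      unfolding measurable_cong_sets[OF sets_L refl] .
    have "emeasure (distr R borel f) D = emeasure R (f -` D \<inter> space path_space)"
      using R(1) sets_eq_imp_space_eq[OF R(1)] f
      by (subst emeasure_distr) (auto cong: measurable_cong_sets)
    also have "\<dots> = (\<integral>\<^sup>+x. emeasure (distr S path_space (path x)) (f -` D \<inter> space path_space) \<partial>\<mu>)"
      by (rule R(2)) (rule measurable_sets[OF f D])
    also have "\<dots> = (\<integral>\<^sup>+x. (\<integral>\<^sup>+w. indicator D (f (path x w)) \<partial>S) \<partial>\<mu>)"
    proof (rule nn_integral_cong)
      fix x
      have [measurable]: "path x \<in> S \<rightarrow>\<^sub>M path_space" by measurable
      have eq: "(\<lambda>s. indicator D (f s) :: ennreal) = indicator (f -` D \<inter> space path_space)"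
        by (auto simp: fun_eq_iff indicator_def space_PiM)
      have "(\<integral>\<^sup>+w. indicator D (f (path x w)) \<partial>S) = (\<integral>\<^sup>+s. indicator D (f s) \<partial>distr S path_space (path x))"
        by (simp add: nn_integral_distr)
      also have "\<dots> = emeasure (distr S path_space (path x)) (f -` D \<inter> space path_space)"
        unfolding eq using measurable_sets[OF f D] by (intro nn_integral_indicator) simp
      finally show "emeasure (distr S path_space (path x)) (f -` D \<inter> space path_space)
          = (\<integral>\<^sup>+w. indicator D (f (path x w)) \<partial>S)" ..
    qed
    also have "\<dots> = (\<integral>\<^sup>+x. c * ?p x * (\<integral>\<^sup>+w. indicator D (f (path x w)) \<partial>S) \<partial>L)"
      unfolding \<mu> by (subst nn_integral_density) simp_all
    also have "\<dots> = c * (\<integral>\<^sup>+x. ?p x * (\<integral>\<^sup>+w. indicator D (f (path x w)) \<partial>S) \<partial>L)"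
      unfolding mult.assoc by (rule nn_integral_cmult) (use pI in \<open>simp only: mult.assoc\<close>)
    finally show ?thesis .
  qed
  show "distr R borel (\<lambda>s. s (?T s)) = \<mu>"
  proof (rule measure_eqI)
    show "sets (distr R borel (\<lambda>s. s (?T s))) = sets \<mu>" by (simp add: \<mu>)
    fix D assume "D \<in> sets (distr R borel (\<lambda>s. s (?T s)))"
    then have [measurable]: "D \<in> sets borel" by simp
    have pD: "(\<lambda>x. ?p x * indicator D x) \<in> borel_measurable L"
      unfolding measurable_cong_sets[OF sets_L refl]
      by (rule borel_measurable_times_ennreal[OF p]) measurable
    have "emeasure (distr R borel (\<lambda>s. s (?T s))) D
        = c * (\<integral>\<^sup>+u. \<integral>\<^sup>+w. indicator B u * indicator A (path u w (Suc 0)) * indicator D (path u w (Suc 0)) \<partial>S \<partial>L)"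
      unfolding law[OF f(1) \<open>D \<in> sets borel\<close>]
      by (subst nn_integral_crossing_pair[OF _ _ _ inf inf_rev n, where G = "\<lambda>a. indicator D"]) simp_all
    \<comment> \<open>\<open>nn_integral_prepend_step\<close> read from right to left: the
      continuation is evaluated only at time 0, where it equals \<open>x\<close>.\<close>
    also have "\<dots> = c * (\<integral>\<^sup>+x. ?p x * (\<integral>\<^sup>+w. indicator D (path x w 0) \<partial>S) \<partial>L)"
      by (subst nn_integral_prepend_step) simp_all
    also have "\<dots> = emeasure \<mu> D"
      unfolding \<mu> using nn_integral_cmult[OF pD, of c]
      by (simp add: emeasure_density P.emeasure_space_1 mult.assoc)
    finally show "emeasure (distr R borel (\<lambda>s. s (?T s))) D = emeasure \<mu> D" .
  qed
  let ?q = "\<lambda>u. indicator B u * emeasure N {t. u + t \<in> A} :: ennreal"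
  have q [measurable]: "?q \<in> borel_measurable borel"
    by measurable
  have [measurable]: "(\<lambda>u. c * ?q u) \<in> borel_measurable L"
    unfolding measurable_cong_sets[OF sets_L refl]
    by (rule borel_measurable_times_ennreal[OF borel_measurable_const q])
  have [measurable]: "{t. u + t \<in> A} \<in> sets N" for u
    by measurable
  show "distr R borel (\<lambda>s. s (?T s - 1)) = density L (\<lambda>u. c * ?q u)"
  proof (rule measure_eqI)
    show "sets (distr R borel (\<lambda>s. s (?T s - 1))) = sets (density L (\<lambda>u. c * ?q u))" by simp
    fix D assume "D \<in> sets (distr R borel (\<lambda>s. s (?T s - 1)))"
    then have [measurable]: "D \<in> sets borel" by simp
    have qD: "(\<lambda>u. ?q u * indicator D u) \<in> borel_measurable L"
      unfolding measurable_cong_sets[OF sets_L refl]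
      by (rule borel_measurable_times_ennreal[OF q]) measurable
    have "emeasure (distr R borel (\<lambda>s. s (?T s - 1))) D
        = c * (\<integral>\<^sup>+u. \<integral>\<^sup>+w. indicator B u * indicator A (path u w (Suc 0)) * indicator D u \<partial>S \<partial>L)"
      unfolding law[OF f(2) \<open>D \<in> sets borel\<close>]
      by (subst nn_integral_crossing_pair[OF _ _ _ inf inf_rev n, where G = "\<lambda>a b. indicator D a"]) simp_all
    \<comment> \<open>Only the first increment enters the integrand, and the remaining ones
      integrate to 1.\<close>
    also have "\<dots> = c * (\<integral>\<^sup>+u. \<integral>\<^sup>+t. indicator B u * indicator D u * indicator {t. u + t \<in> A} t \<partial>N \<partial>L)"
      by (subst nn_integral_S_case_nat)
        (simp_all add: path_case_nat P.emeasure_space_1 mult_ac indicator_def)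
    also have "\<dots> = c * (\<integral>\<^sup>+u. ?q u * indicator D u \<partial>L)"
      by (subst nn_integral_cmult) (simp_all add: mult_ac)
    also have "\<dots> = emeasure (density L (\<lambda>u. c * ?q u)) D"
      using nn_integral_cmult[OF qD, of c] by (simp add: emeasure_density mult.assoc)
    finally show "emeasure (distr R borel (\<lambda>s. s (?T s - 1))) D = emeasure (density L (\<lambda>u. c * ?q u)) D" .
  qed
qed

end

subsection \<open>Lattices and their Haar measure\<close>

lemma lattice_uminus:
  assumes "x \<in> lattice d"
  shows "- x \<in> lattice d"
proof (cases "d = 0")
  case False
  with assms obtain k :: int where "x = d * k" by (auto simp: lattice_def)
  then have "- x = d * of_int (- k)" by simp
  then have "\<exists>k :: int. - x = d * k" by blast
  with False show ?thesis by (simp add: lattice_def)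
qed (simp add: lattice_def)

lemma lattice_add:
  assumes "x \<in> lattice d" "y \<in> lattice d"
  shows "x + y \<in> lattice d"
proof (cases "d = 0")
  case False
  with assms obtain i j :: int where "x = d * i" "y = d * j" by (auto simp: lattice_def)
  then have "x + y = d * of_int (i + j)" by (simp add: distrib_left)
  then have "\<exists>k :: int. x + y = d * k" by blast
  with False show ?thesis by (simp add: lattice_def)
qed (simp add: lattice_def)

lemma lattice_self: "d \<in> lattice d"
proof (cases "d = 0")
  case False
  have "d = d * of_int 1" by simp
  then have "d \<in> {d * of_int k | k :: int. True}" by blast
  with False show ?thesis by (simp only: lattice_def if_False)
qed (simp add: lattice_def)

lemma countable_lattice:
  assumes "d \<noteq> 0"
  shows "countable (lattice d)"
proof -
  have "lattice d = range (\<lambda>k :: int. d * k)"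
    using assms by (auto simp: lattice_def)
  then show ?thesis by simp
qed

lemma lattice_borel [measurable]: "lattice d \<in> sets borel"
proof (cases "d = 0")
  case False
  from sets.countable[OF _ countable_lattice[OF this], of borel] show ?thesis by simp
qed (simp add: lattice_def)

section \<open>Invariance and sigma-finiteness of the lattice measure\<close>

lemma sets_lattice_measure [measurable_cong, simp]: "sets (lattice_measure d) = sets borel"
  by (simp add: lattice_measure_def)

lemma emeasure_lattice_measure:
  assumes "d \<noteq> 0" "E \<in> sets borel"
  shows "emeasure (lattice_measure d) E = ennreal d * emeasure (count_space (lattice d)) (E \<inter> lattice d)"
  using assms by (simp add: lattice_measure_def emeasure_distr)

lemma AE_lattice_measure: "AE x in lattice_measure d. x \<in> lattice d"
proof (cases "d = 0")
  case False
  have "- lattice d \<in> sets borel"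
    by (intro borel_comp lattice_borel)
  moreover from this have "emeasure (lattice_measure d) (- lattice d) = 0"
    by (simp add: emeasure_lattice_measure[OF False])
  ultimately have "- lattice d \<in> null_sets (lattice_measure d)"
    by (intro null_setsI) simp_all
  then show ?thesis by (rule AE_I') blast
qed (simp add: lattice_def)

lemma distr_lattice_measure_bij:
  assumes d: "d \<noteq> 0" and f [measurable]: "f \<in> borel_measurable borel"
    and bij: "bij_betw f (lattice d) (lattice d)"
  shows "distr (lattice_measure d) borel f = lattice_measure d"
proof (rule measure_eqI)
  fix E assume "E \<in> sets (distr (lattice_measure d) borel f)"
  then have E [measurable]: "E \<in> sets borel" by simp
  have "emeasure (distr (lattice_measure d) borel f) E = emeasure (lattice_measure d) (f -` E)"
    using sets_eq_imp_space_eq[OF sets_lattice_measure[of d]] by (subst emeasure_distr) auto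
  also have "\<dots> = ennreal d * emeasure (count_space (lattice d)) (f -` E \<inter> lattice d)"
    using measurable_sets[OF f E] by (simp add: emeasure_lattice_measure d)
  \<comment> \<open>As \<open>f\<close> maps the lattice into itself, \<open>E\<close> can be cut
    down to the lattice; then the invariance of counting measure under bijections applies.\<close>
  also have "f -` E \<inter> lattice d = f -` (E \<inter> lattice d) \<inter> lattice d"
    using bij by (auto simp: bij_betw_def)
  also have "emeasure (count_space (lattice d)) (f -` (E \<inter> lattice d) \<inter> lattice d)
      = emeasure (distr (count_space (lattice d)) (count_space (lattice d)) f) (E \<inter> lattice d)"
    using bij by (subst emeasure_distr) (auto simp: bij_betw_def)
  also have "\<dots> = emeasure (count_space (lattice d)) (E \<inter> lattice d)"
    by (simp add: distr_bij_count_space[OF bij])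
  also have "ennreal d * \<dots> = emeasure (lattice_measure d) E"
    by (simp add: emeasure_lattice_measure d)
  finally show "emeasure (distr (lattice_measure d) borel f) E = emeasure (lattice_measure d) E" .
qed simp

lemma lattice_measure_translate:
  assumes "t \<in> lattice d"
  shows "distr (lattice_measure d) borel ((+) t) = lattice_measure d"
proof (cases "d = 0")
  case True
  then show ?thesis by (simp add: lattice_measure_def lborel_distr_plus)
next
  case False
  have "bij_betw ((+) t) (lattice d) (lattice d)"
    using lattice_add[OF assms] lattice_add[OF lattice_uminus[OF assms]]
    by (intro bij_betw_byWitness[where f' = "(+) (- t)"]) auto
  then show ?thesis by (intro distr_lattice_measure_bij False) auto
qed

lemma lattice_measure_minus: "distr (lattice_measure d) borel uminus = lattice_measure d"
proof (cases "d = 0")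
  case True
  then show ?thesis by (simp add: lattice_measure_def lborel_distr_uminus)
next
  case False
  have "bij_betw uminus (lattice d) (lattice d)"
    by (rule bij_betw_byWitness[where f' = uminus]) (auto intro: lattice_uminus)
  then show ?thesis by (intro distr_lattice_measure_bij False) auto
qed

lemma sigma_finite_lattice_measure: "sigma_finite_measure (lattice_measure d)"
proof (cases "d = 0")
  case True
  then show ?thesis by (simp add: lattice_measure_def sigma_finite_lborel)
next
  case False
  show ?thesis
  proof
    show "\<exists>A. countable A \<and> A \<subseteq> sets (lattice_measure d) \<and> \<Union> A = space (lattice_measure d)
        \<and> (\<forall>a\<in>A. emeasure (lattice_measure d) a \<noteq> \<infinity>)"
    \<comment> \<open>Countable cover for \<open>d \<noteq> 0\<close>: the lattice points as
      singletons, each of mass \<open>d\<close>, and the null complement of the lattice.\<close>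
    proof (intro exI[of _ "insert (- lattice d) ((\<lambda>x. {x}) ` lattice d)"] conjI ballI)
      fix a assume a: "a \<in> insert (- lattice d) ((\<lambda>x. {x}) ` lattice d)"
      then have "finite (a \<inter> lattice d)" by auto
      moreover have "a \<in> sets borel" using a borel_comp[OF lattice_borel[of d]] by auto
      ultimately show "emeasure (lattice_measure d) a \<noteq> \<infinity>"
        by (simp add: emeasure_lattice_measure False ennreal_mult_eq_top_iff)
    next
      show "countable (insert (- lattice d) ((\<lambda>x. {x}) ` lattice d))"
        using countable_lattice[OF False] by simp
      show "insert (- lattice d) ((\<lambda>x. {x}) ` lattice d) \<subseteq> sets (lattice_measure d)"
        using borel_comp[OF lattice_borel[of d]] by auto
      have "space (lattice_measure d) = UNIV"
        using sets_eq_imp_space_eq[OF sets_lattice_measure[of d]] by simp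
      then show "\<Union> (insert (- lattice d) ((\<lambda>x. {x}) ` lattice d)) = space (lattice_measure d)"
        by auto
    qed
  qed
qed

text \<open>On the lattice, closing the half-line at its end point amounts to a shift by \<open>d\<close>; for
  \<open>d = 0\<close> the two half-lines have equal mass off the countably many atoms.\<close>

lemma AE_lattice_measure_gap:
  assumes "prob_space N" and [measurable_cong, simp]: "sets N = sets borel"
    and "0 \<le> d" and N: "AE t in N. t \<in> lattice d"
  shows "AE w in lattice_measure d. (0 \<le> w \<longleftrightarrow> 0 < w + d) \<and> (AE t in N. w + d \<le> t \<longleftrightarrow> w < t)"
proof (cases "d = 0")
  case True
  interpret prob_space N by fact
  have "AE w in lborel. w \<noteq> 0"
    by (rule AE_lborel_singleton)
  moreover have "AE w in lborel. w \<notin> {x. measure N {x} \<noteq> 0}"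
    using countable_support by (intro AE_not_in countable_imp_null_set_lborel)
  ultimately have "AE w in lborel. (0 \<le> w \<longleftrightarrow> 0 < w + d) \<and> (AE t in N. w + d \<le> t \<longleftrightarrow> w < t)"
  proof eventually_elim
    case (elim w)
    have "AE t in N. t \<noteq> w"
      using elim by (intro AE_I[of _ _ "{w}"]) (auto simp: emeasure_eq_measure)
    then have "AE t in N. w + d \<le> t \<longleftrightarrow> w < t"
      by eventually_elim (auto simp: True)
    with elim show ?case by (auto simp: True)
  qed
  moreover have "lattice_measure d = lborel"
    by (simp add: lattice_measure_def True)
  ultimately show ?thesis by (simp only:)
next
  case False
  with assms have d: "d > 0" by simp
  have gap: "x + d \<le> y \<longleftrightarrow> x < y" if xy: "x \<in> lattice d" "y \<in> lattice d" for x y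
  proof -
    obtain i j :: int where "x = d * i" "y = d * j"
      using xy d by (auto simp: lattice_def)
    moreover have "d * i + d \<le> d * j \<longleftrightarrow> d * (i + 1) \<le> d * j" by (simp add: algebra_simps)
    ultimately show ?thesis using d by simp linarith
  qed
  have "0 \<in> lattice d"
    using lattice_add[OF lattice_self lattice_uminus[OF lattice_self]] by simp
  have "0 \<le> w \<longleftrightarrow> 0 < w + d" if "w \<in> lattice d" for w
    using gap[OF that \<open>0 \<in> lattice d\<close>] by linarith
  moreover have "AE t in N. w + d \<le> t \<longleftrightarrow> w < t" if "w \<in> lattice d" for w
    using N by eventually_elim (use gap that in auto)
  ultimately show ?thesis
    using AE_lattice_measure[of d] by (auto elim!: eventually_mono)
qed

section \<open>Attainment of the span\<close>

text \<open>The span is defined as a supremum, so it has to be shown that the set \<open>H\<close>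
  of admissible mesh sizes is bounded and contains its supremum. Both follow from a nonzero value of
  \<open>Y\<close> that lies in countably many lattices at once.\<close>

lemma span_of_attained:
  assumes "prob_space M" and Y [measurable]: "Y \<in> borel_measurable M"
    and nonzero: "\<not> (AE \<omega> in M. Y \<omega> = 0)"
  shows "0 \<le> span_of M Y" and "AE \<omega> in M. Y \<omega> \<in> lattice (span_of M Y)"
proof -
  interpret prob_space M by fact
  define H where "H = {h. 0 \<le> h \<and> (AE \<omega> in M. Y \<omega> \<in> lattice h)}"
  have span: "span_of M Y = Sup H"
  proof -
    have "prob {\<omega> \<in> space M. Y \<omega> \<in> lattice h} = 1 \<longleftrightarrow> (AE \<omega> in M. Y \<omega> \<in> lattice h)" for h
      by (rule prob_Collect_eq_1) measurable
    then show ?thesis unfolding span_of_def H_def by simp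
  qed
  have "0 \<in> H" by (simp add: H_def lattice_def)
  \<comment> \<open>Countably many almost sure statements hold together, and if 0 were the only
    common lattice point, \<open>Y\<close> would vanish almost surely.\<close>
  have "\<exists>x. x \<noteq> 0 \<and> (\<forall>n. x \<in> lattice (h n))" if h: "\<And>n. h n \<in> H" for h :: "nat \<Rightarrow> real"
  proof -
    have AE: "AE \<omega> in M. \<forall>n. Y \<omega> \<in> lattice (h n)"
      unfolding AE_all_countable using h by (auto simp: H_def)
    show ?thesis
    proof (rule ccontr)
      assume no: "\<not> ?thesis"
      from AE have "AE \<omega> in M. Y \<omega> = 0"
        by eventually_elim (use no in blast)
      with nonzero show False ..
    qed
  qed
  note common = this
  have le: "h \<le> \<bar>x\<bar>" if hx: "0 \<le> h" "x \<noteq> 0" "x \<in> lattice h" for h x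
  proof (cases "h = 0")
    case False
    then obtain k :: int where k: "x = h * k" using hx(3) by (auto simp: lattice_def)
    with hx have "1 \<le> \<bar>k\<bar>" by auto
    then have "h * 1 \<le> h * \<bar>real_of_int k\<bar>" using hx(1) by (intro mult_left_mono) linarith+
    with hx show ?thesis by (simp add: k abs_mult)
  qed simp
  have bdd: "bdd_above H"
  proof (rule ccontr)
    assume "\<not> bdd_above H"
    then have "\<exists>h\<in>H. real n < h" for n by (auto simp: bdd_above_def not_le)
    then obtain h where h: "\<And>n. h n \<in> H" "\<And>n. real n < h n" by metis
    obtain x where x: "x \<noteq> 0" "\<And>n. x \<in> lattice (h n)" using common[of h] h(1) by metis
    have "real n < \<bar>x\<bar>" for n
    proof -
      have "h n \<le> \<bar>x\<bar>" using le[of "h n" x] h(1)[of n] x by (simp add: H_def)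
      with h(2)[of n] show ?thesis by linarith
    qed
    then show False using reals_Archimedean2[of "\<bar>x\<bar>"] by (meson less_asym)
  qed
  show nonneg: "0 \<le> span_of M Y"
    unfolding span using bdd \<open>0 \<in> H\<close> by (rule cSup_upper[rotated])
  have "Sup H \<in> H"
  proof (cases "Sup H = 0")
    case False
    define d where "d = Sup H"
    have "d > 0" using False nonneg by (simp add: span d_def)
    have "d \<in> closure H"
      unfolding d_def using bdd \<open>0 \<in> H\<close> by (intro closure_contains_Sup) auto
    then obtain h where h: "\<And>n. h n \<in> H" "h \<longlonglongrightarrow> d" by (auto simp: closure_sequential)
    obtain x where x: "x \<noteq> 0" "\<And>n. x \<in> lattice (h n)" using common[of h] h(1) by metis
    \<comment> \<open>A mesh size above \<open>d / 2\<close> whose lattice contains \<open>x\<close>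
      has the form \<open>x / k\<close> with \<open>k\<close> bounded in terms of \<open>x\<close>
      and \<open>d\<close>; hence only finitely many values occur.\<close>
    define F where "F = (\<lambda>k. x / real_of_int k) ` {k. \<bar>real_of_int k\<bar> \<le> 2 * \<bar>x\<bar> / d}"
    have "{k :: int. \<bar>real_of_int k\<bar> \<le> 2 * \<bar>x\<bar> / d} \<subseteq> {- \<lceil>2 * \<bar>x\<bar> / d\<rceil>..\<lceil>2 * \<bar>x\<bar> / d\<rceil>}"
    proof
      fix k :: int assume "k \<in> {k. \<bar>real_of_int k\<bar> \<le> 2 * \<bar>x\<bar> / d}"
      then have "real_of_int \<bar>k\<bar> \<le> 2 * \<bar>x\<bar> / d" by simp
      also have "\<dots> \<le> real_of_int \<lceil>2 * \<bar>x\<bar> / d\<rceil>" by (rule le_of_int_ceiling)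
      finally have "\<bar>k\<bar> \<le> \<lceil>2 * \<bar>x\<bar> / d\<rceil>" unfolding of_int_le_iff .
      then show "k \<in> {- \<lceil>2 * \<bar>x\<bar> / d\<rceil>..\<lceil>2 * \<bar>x\<bar> / d\<rceil>}"
        by auto
    qed
    then have "finite F"
      unfolding F_def by (intro finite_imageI) (rule finite_subset, auto)
    have F: "h n \<in> F" if "d / 2 < h n" for n
    proof -
      have pos: "h n > 0" using that \<open>d > 0\<close> by linarith
      obtain k :: int where k: "x = h n * k" using x(2)[of n] pos by (auto simp: lattice_def)
      with x have "k \<noteq> 0" by auto
      have "\<bar>real_of_int k\<bar> * d \<le> \<bar>real_of_int k\<bar> * (2 * h n)"
        using that by (intro mult_left_mono) auto
      then have "\<bar>real_of_int k\<bar> \<le> 2 * \<bar>x\<bar> / d"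
        using \<open>d > 0\<close> pos by (simp add: k abs_mult field_simps)
      moreover have "h n = x / k" using k \<open>k \<noteq> 0\<close> by simp
      ultimately show ?thesis unfolding F_def by blast
    qed
    have ev: "eventually (\<lambda>n. d / 2 < h n) sequentially"
      using h(2) \<open>d > 0\<close> by (intro order_tendstoD(1)) auto
    \<comment> \<open>A sequence that converges to \<open>d\<close> and eventually takes values in a
      finite set is eventually equal to \<open>d\<close>, because the other values form a closed set
      without \<open>d\<close>.\<close>
    have "open (- (F - {d}))"
      using \<open>finite F\<close> by (intro open_Compl finite_imp_closed) auto
    from topological_tendstoD[OF h(2) this]
    have "eventually (\<lambda>n. h n \<notin> F - {d}) sequentially"
      by (rule eventually_mono) auto
    then have "eventually (\<lambda>n. h n = d) sequentially"
      using ev by eventually_elim (use F in auto)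
    then obtain n where "h n = d" by (auto simp: eventually_sequentially)
    with h(1)[of n] show ?thesis by (simp add: d_def)
  qed (use \<open>0 \<in> H\<close> in simp)
  then show "AE \<omega> in M. Y \<omega> \<in> lattice (span_of M Y)"
    by (simp add: span H_def)
qed

text \<open>A path from \<open>x\<close> is a translate of the path from 0, so its crossings are
  those of the path from 0 between translated sets. Hence a single null set of increments works for
  every start.\<close>

lemma oscillating_path_crosses:
  assumes "oscillating (path 0 w)" and AB: "A \<union> B = UNIV"
    and half_lines: "(\<exists>c. {..<c} \<subseteq> B \<and> {c<..} \<subseteq> A) \<or> (\<exists>c. {c<..} \<subseteq> B \<and> {..<c} \<subseteq> A)"
  shows "\<exists>\<^sub>\<infinity>j. crosses B A (path x w) j"
proof -
  have "crosses B A (path x w) j \<longleftrightarrow> crosses ((+) x -` B) ((+) x -` A) (path 0 w) j" for j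
    by (simp add: crosses_def path_def)
  moreover have "\<exists>\<^sub>\<infinity>j. crosses ((+) x -` B) ((+) x -` A) (path 0 w) j"
  proof (rule oscillating_crosses[OF assms(1)])
    show "(+) x -` A \<union> (+) x -` B = UNIV" using AB by auto
    from half_lines show "(\<exists>c. {..<c} \<subseteq> (+) x -` B \<and> {c<..} \<subseteq> (+) x -` A)
        \<or> (\<exists>c. {c<..} \<subseteq> (+) x -` B \<and> {..<c} \<subseteq> (+) x -` A)"
    proof (elim disjE exE)
      fix c assume "{..<c} \<subseteq> B \<and> {c<..} \<subseteq> A"
      then show ?thesis by (intro disjI1 exI[of _ "c - x"]) (auto simp: subset_iff)
    next
      fix c assume "{c<..} \<subseteq> B \<and> {..<c} \<subseteq> A"
      then show ?thesis by (intro disjI2 exI[of _ "c - x"]) (auto simp: subset_iff)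
    qed
  qed
  ultimately show ?thesis by simp
qed

subsection \<open>Invariance of the crossing laws\<close>

text \<open>Reflection and exchange of the two sets cancel as far as the direction is concerned:
  reversed up-crossings are again up-crossings, now at level \<open>- c\<close>.\<close>

lemma half_lines_uminus:
  fixes A B :: "real set"
  assumes "(\<exists>c. {..<c} \<subseteq> B \<and> {c<..} \<subseteq> A) \<or> (\<exists>c. {c<..} \<subseteq> B \<and> {..<c} \<subseteq> A)"
  shows "(\<exists>c. {..<c} \<subseteq> uminus ` A \<and> {c<..} \<subseteq> uminus ` B)
    \<or> (\<exists>c. {c<..} \<subseteq> uminus ` A \<and> {..<c} \<subseteq> uminus ` B)"
proof -
  have lower: "{..<- c} \<subseteq> uminus ` C" if "{c<..} \<subseteq> C" for c and C :: "real set"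
    using image_mono[OF that, of uminus] by (simp only: image_uminus_greaterThan)
  have upper: "{- c<..} \<subseteq> uminus ` C" if "{..<c} \<subseteq> C" for c and C :: "real set"
    using image_mono[OF that, of uminus] by (simp only: image_uminus_lessThan)
  from assms show ?thesis
    using lower upper by blast
qed

text \<open>Independence identifies the joint law on the index set \<open>{1..}\<close> with a
  product measure, and \<open>Suc\<close> carries the natural numbers bijectively onto that
  set.\<close>

lemma distr_increments:
  fixes X :: "nat \<Rightarrow> 'a \<Rightarrow> real"
  assumes "prob_space M" and indep: "prob_space.indep_vars M (\<lambda>_. borel) X {1..}"
    and ident: "\<And>n. n \<ge> 1 \<Longrightarrow> distr M borel (X n) = distr M borel (X 1)"
  shows "distr M path_space (\<lambda>\<omega> n. X (Suc n) \<omega>) = Pi\<^sub>M UNIV (\<lambda>_. distr M borel (X 1))"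
proof -
  interpret prob_space M by fact
  define N where "N = distr M borel (X 1)"
  have rv: "X i \<in> borel_measurable M" if "i \<in> {1..}" for i
    using indep that unfolding indep_vars_def by auto
  have N: "prob_space N"
    unfolding N_def using rv by (intro prob_space_distr) auto
  have sets_N: "sets (Pi\<^sub>M I (\<lambda>_. N)) = sets (Pi\<^sub>M I (\<lambda>_. borel))" for I :: "nat set"
    by (rule sets_PiM_cong) (auto simp: N_def)
  have restrict: "(\<lambda>x. \<lambda>i\<in>{1..}. X i x) \<in> M \<rightarrow>\<^sub>M Pi\<^sub>M {1..} (\<lambda>_. borel)"
    using rv by (intro measurable_restrict) auto
  have shift: "(\<lambda>\<omega> n. \<omega> (Suc n)) \<in> Pi\<^sub>M {1..} (\<lambda>_. borel) \<rightarrow>\<^sub>M (path_space :: (nat \<Rightarrow> real) measure)"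
    by (rule measurable_PiM_single') auto
  have "distr M (Pi\<^sub>M {1..} (\<lambda>_. borel)) (\<lambda>x. \<lambda>i\<in>{1..}. X i x) = Pi\<^sub>M {1..} (\<lambda>i. distr M borel (X i))"
    using indep rv by (subst (asm) indep_vars_iff_distr_eq_PiM') auto
  also have "\<dots> = Pi\<^sub>M {1..} (\<lambda>_. N)"
    unfolding N_def by (intro PiM_cong refl ident) simp
  finally have joint: "distr M (Pi\<^sub>M {1..} (\<lambda>_. borel)) (\<lambda>x. \<lambda>i\<in>{1..}. X i x) = Pi\<^sub>M {1..} (\<lambda>_. N)" .
  have "distr M path_space (\<lambda>\<omega> n. X (Suc n) \<omega>)
      = distr (distr M (Pi\<^sub>M {1..} (\<lambda>_. borel)) (\<lambda>x. \<lambda>i\<in>{1..}. X i x)) path_space (\<lambda>\<omega> n. \<omega> (Suc n))"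
    unfolding distr_distr[OF shift restrict] by (simp add: comp_def)
  also have "\<dots> = distr (Pi\<^sub>M {1..} (\<lambda>_. N)) (Pi\<^sub>M UNIV (\<lambda>_. N)) (\<lambda>\<omega>. \<lambda>n\<in>UNIV. \<omega> (Suc n))"
    unfolding joint by (intro distr_cong) (simp_all add: sets_N restrict_def)
  also have "\<dots> = Pi\<^sub>M UNIV (\<lambda>_. N)"
    using N by (intro distr_PiM_reindex) auto
  finally show ?thesis by (simp add: N_def)
qed

text \<open>The reversible walk with \<open>L = lattice_measure d\<close> yields both claims. For
  the undershoots, \<open>dual\<close> says that the involution \<open>u \<mapsto> - u - d\<close>,
  which preserves \<open>L\<close>, carries the density of the undershoot to that of
  \<open>\<mu>\<close>.\<close>

lemma crossing_invariant:
  fixes M :: "'a measure" and X :: "nat \<Rightarrow> 'a \<Rightarrow> real"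
  defines "N \<equiv> distr M borel (X 1)"
  assumes "prob_space M" and indep: "prob_space.indep_vars M (\<lambda>_. borel) X {1..}"
    and ident: "\<And>n. n \<ge> 1 \<Longrightarrow> distr M borel (X n) = distr M borel (X 1)"
    and osc: "AE s in walk_law M X 0. oscillating s"
    and lattice: "AE t in N. t \<in> lattice d"
    and A [measurable]: "A \<in> sets borel" and B [measurable]: "B \<in> sets borel"
    and AB: "A \<union> B = UNIV"
    and half_lines: "(\<exists>c. {..<c} \<subseteq> B \<and> {c<..} \<subseteq> A) \<or> (\<exists>c. {c<..} \<subseteq> B \<and> {..<c} \<subseteq> A)"
    and \<mu>: "\<mu> = density (lattice_measure d) (\<lambda>x. c * (indicator A x * emeasure N {t. x - t \<in> B}))"
    and dual: "AE w in lattice_measure d. indicator B (- w - d) * emeasure N {t. - w - d + t \<in> A}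
        = (indicator A w * emeasure N {t. w - t \<in> B} :: ennreal)"
    and n: "n \<ge> 1"
  shows "distr (walk_law_init M X \<mu>) borel (\<lambda>s. s (crossing_time B A s n)) = \<mu>"
    and "distr (walk_law_init M X \<mu>) borel (\<lambda>s. - s (crossing_time B A s n - 1) - d) = \<mu>"
proof -
  interpret M: prob_space M by fact
  have rv: "X i \<in> borel_measurable M" if "i \<ge> 1" for i
    using indep that unfolding M.indep_vars_def by auto
  interpret N: prob_space N
    unfolding N_def using rv by (intro M.prob_space_distr) auto
  let ?L = "lattice_measure d"
  have prod: "product_prob_space (\<lambda>_::nat. N)"
    by (rule product_prob_spaceI) (rule N.prob_space_axioms)
  have translate: "AE t in N. distr ?L borel ((+) t) = ?L"
    using lattice by eventually_elim (rule lattice_measure_translate)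
  have "sets N = sets borel"
    by (simp add: N_def)
  then have "reversible_walk_axioms N ?L"
    using translate
    by (intro reversible_walk_axioms.intro) (simp_all only: sets_lattice_measure sigma_finite_lattice_measure lattice_measure_minus)
  then have rw: "reversible_walk N ?L"
    by (intro reversible_walk.intro sequence_space.intro prod)
  interpret reversible_walk N ?L by (rule rw)
  have law: "walk_law M X x = distr S path_space (path x)" for x
  proof -
    have "walk X x = (\<lambda>\<omega>. path x (\<lambda>n. X (Suc n) \<omega>))"
      by (auto simp: walk_def path_def fun_eq_iff sum.atLeast1_atMost_eq)
    moreover have [measurable]: "(\<lambda>\<omega> n. X (Suc n) \<omega>) \<in> M \<rightarrow>\<^sub>M path_space"
      using rv by (intro measurable_PiM_single') auto
    ultimately have "walk_law M X x = distr (distr M path_space (\<lambda>\<omega> n. X (Suc n) \<omega>)) path_space (path x)"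
      by (simp add: walk_law_def distr_distr comp_def)
    then show ?thesis
      by (simp only: distr_increments[OF assms(2) indep ident] N_def)
  qed
  have osc': "AE w in S. oscillating (path 0 w)"
    using osc unfolding law by (rule AE_distrD[rotated]) measurable
  have inf: "AE w in S. \<forall>x. \<exists>\<^sub>\<infinity>j. crosses B A (path x w) j"
    using osc' by eventually_elim (use oscillating_path_crosses[OF _ AB half_lines] in blast)
  have "uminus ` B \<union> uminus ` A = UNIV"
    using AB by (metis Un_commute image_Un surj_uminus)
  note rev = oscillating_path_crosses[OF _ this half_lines_uminus[OF half_lines]]
  have inf_rev: "AE w in S. \<forall>x. \<exists>\<^sub>\<infinity>j. crosses (uminus ` A) (uminus ` B) (path x w) j"
    using osc' by eventually_elim (use rev in blast)
  define R where "R = walk_law_init M X \<mu>"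
  have sets_R: "sets R = sets path_space"
    unfolding R_def walk_law_init_def by (simp add: sets.space_closed sets.sigma_sets_eq)
  have R: "emeasure R E = (\<integral>\<^sup>+x. emeasure (distr S path_space (path x)) E \<partial>\<mu>)"
    if "E \<in> sets path_space" for E
    unfolding R_def law[symmetric] using rv that
    by (intro emeasure_walk_law_init) (simp_all add: \<mu> M.prob_space_axioms)
  note crossing = distr_crossing[OF A B inf inf_rev n \<mu> sets_R R]
  show "distr (walk_law_init M X \<mu>) borel (\<lambda>s. s (crossing_time B A s n)) = \<mu>"
    using crossing(1) by (simp add: R_def)
  let ?f = "\<lambda>u. - u - d"
  let ?q = "\<lambda>u. c * (indicator B u * emeasure N {t. u + t \<in> A})"
  have q: "?q \<in> borel_measurable borel"
    by (intro borel_measurable_times_ennreal) measurable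
  have L_f: "distr ?L borel ?f = ?L"
  proof -
    \<comment> \<open>A reflection followed by a translation by the lattice point
      \<open>- d\<close>.\<close>
    have "?f = (+) (- d) \<circ> uminus"
      by (simp add: fun_eq_iff)
    then have "distr ?L borel ?f = distr (distr ?L borel uminus) borel ((+) (- d))"
      by (simp only:) (subst distr_distr, simp_all)
    then show ?thesis
      by (simp add: L_minus lattice_measure_translate lattice_uminus lattice_self)
  qed
  have "(\<lambda>s. s (crossing_time B A s n - 1)) \<in> borel_measurable path_space"
    by measurable
  then have "distr R borel (\<lambda>s. - s (crossing_time B A s n - 1) - d)
      = distr (distr R borel (\<lambda>s. s (crossing_time B A s n - 1))) borel ?f"
    using sets_R by (subst distr_distr) (auto simp: comp_def cong: measurable_cong_sets)
  also have "\<dots> = distr (density ?L ?q) borel ?f"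
    by (simp only: crossing(2))
  \<comment> \<open>\<open>?f\<close> is an involution; inserting it twice writes the density as a
    function of the image point \<open>?f u\<close>, as a change of variables requires.\<close>
  also have "\<dots> = distr (density ?L (\<lambda>u. ?q (?f (?f u)))) borel ?f"
    by simp
  also have "\<dots> = density (distr ?L borel ?f) (\<lambda>u. ?q (?f u))"
    by (rule density_distr[symmetric]) (use measurable_compose[OF _ q, of ?f borel] in simp_all)
  also have "\<dots> = density ?L (\<lambda>u. ?q (?f u))"
    by (simp only: L_f)
  also have "\<dots> = \<mu>"
    unfolding \<mu>
  proof (rule density_cong)
    show "AE w in ?L. ?q (?f w) = c * (indicator A w * emeasure N {t. w - t \<in> B})"
      using dual by eventually_elim simp
    have "(\<lambda>x. c * (indicator A x * emeasure N {t. x - t \<in> B})) \<in> borel_measurable borel"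
      by (intro borel_measurable_times_ennreal) measurable
    then show "(\<lambda>x. c * (indicator A x * emeasure N {t. x - t \<in> B})) \<in> borel_measurable ?L"
      by (simp cong: measurable_cong_sets)
    show "(\<lambda>u. ?q (?f u)) \<in> borel_measurable ?L"
      using measurable_compose[OF _ q, of ?f borel] by (simp cong: measurable_cong_sets)
  qed
  finally show "distr (walk_law_init M X \<mu>) borel (\<lambda>s. - s (crossing_time B A s n - 1) - d) = \<mu>"
    by (simp add: R_def)
qed

theorem theorem1:
  fixes M :: "'a measure" and X :: "nat \<Rightarrow> 'a \<Rightarrow> real" and d :: real
  assumes "prob_space M"
    and "prob_space.indep_vars M (\<lambda>_. borel) X {1..}"
    and "\<And>n. n \<ge> 1 \<Longrightarrow> distr M borel (X n) = distr M borel (X 1)"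
    and "\<not> (\<exists>c. AE \<omega> in M. X 1 \<omega> = c)"
    and "AE s in walk_law M X 0. oscillating s"
    and "d = span_of M (X 1)"
  shows "\<forall>n\<ge>1.
      distr (walk_law_init M X (pi_plus M (X 1))) borel (overshoot_up n) = pi_plus M (X 1)
    \<and> distr (walk_law_init M X (pi_plus M (X 1))) borel (\<lambda>s. - undershoot_up n s - d)
        = pi_plus M (X 1)
    \<and> distr (walk_law_init M X (pi_minus M (X 1))) borel (overshoot_down n) = pi_minus M (X 1)
    \<and> distr (walk_law_init M X (pi_minus M (X 1))) borel (\<lambda>s. - undershoot_down n s - d)
        = pi_minus M (X 1)"
proof -
  interpret prob_space M by fact
  have X1 [measurable]: "X 1 \<in> borel_measurable M"
    using assms(2) unfolding indep_vars_def by auto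
  define N where "N = distr M borel (X 1)"
  define c where "c = ennreal (norm_const M (X 1))"
  let ?L = "lattice_measure d"
  \<comment> \<open>Non-degeneracy excludes the increment that is almost surely 0, for which every
    mesh size is admissible and the span is not attained.\<close>
  have "\<not> (AE \<omega> in M. X 1 \<omega> = 0)"
    using assms(4) by blast
  note span = span_of_attained[OF assms(1) X1 this, folded assms(6)]
  have sets_N [measurable_cong, simp]: "sets N = sets borel"
    by (simp add: N_def)
  have N: "prob_space N"
    unfolding N_def using X1 by (rule prob_space_distr)
  have lattice: "AE t in N. t \<in> lattice d"
    unfolding N_def using span(2) X1 by (subst AE_distr_iff) simp_all
  interpret N: prob_space N by fact
  have "norm_const M (X 1) \<ge> 0"
    by (simp add: norm_const_def)
  then have density_pi: "density (density ?L (indicator (lattice d \<inter> C)))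
        (\<lambda>x. ennreal (norm_const M (X 1) * \<P>(\<omega> in M. X 1 \<omega> \<in> E x)))
      = density ?L (\<lambda>x. c * (indicator C x * emeasure N (E x)))"
    if [measurable]: "C \<in> sets borel" "(\<lambda>x. emeasure N (E x)) \<in> borel_measurable borel"
      and E: "\<And>x. E x \<in> sets borel" for C E
  proof -
    have "\<P>(\<omega> in M. X 1 \<omega> \<in> E x) = measure N (E x)" for x
      unfolding N_def using X1 E by (simp add: measure_distr vimage_def Int_def conj_commute)
    then have "ennreal (norm_const M (X 1) * \<P>(\<omega> in M. X 1 \<omega> \<in> E x)) = c * emeasure N (E x)" for x
      using \<open>norm_const M (X 1) \<ge> 0\<close> by (simp add: c_def N.emeasure_eq_measure ennreal_mult)
    then have "density (density ?L (indicator (lattice d \<inter> C)))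
        (\<lambda>x. ennreal (norm_const M (X 1) * \<P>(\<omega> in M. X 1 \<omega> \<in> E x)))
      = density ?L (\<lambda>x. indicator (lattice d \<inter> C) x * (c * emeasure N (E x)))"
      by (simp only:) (rule density_density_eq, measurable)
    also have "\<dots> = density ?L (\<lambda>x. c * (indicator C x * emeasure N (E x)))"
      using AE_lattice_measure[of d]
      by (intro density_cong) (auto simp: indicator_def elim!: eventually_mono)
    finally show ?thesis .
  qed
  have [simp]: "space N = UNIV"
    by (simp add: N_def)
  have emeasure_measurable: "(\<lambda>x. emeasure N {t. x - t \<in> B}) \<in> borel_measurable borel"
    if [measurable]: "B \<in> sets borel" for B :: "real set"
    by measurable
  \<comment> \<open>The condition \<open>t > x\<close> is read as \<open>x - t < 0\<close>: a step
    \<open>t\<close> that ends in \<open>x\<close> started below 0. This is the density of the end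
    point of an up-crossing.\<close>
  have pi_plus: "pi_plus M (X 1)
      = density ?L (\<lambda>x. c * (indicator {0..} x * emeasure N {t. x - t \<in> {..<0}}))"
  proof -
    have "{t. x - t \<in> {..<0}} = {x<..}" for x :: real
      by auto
    moreover have "(\<lambda>x. emeasure N {t. x - t \<in> {..<0}}) \<in> borel_measurable borel"
      by (rule emeasure_measurable) simp
    ultimately show ?thesis
      using density_pi[of "{0..}" "\<lambda>x. {x<..}"]
      by (simp add: pi_plus_def lattice_measure_pos_def assms(6))
  qed
  have pi_minus: "pi_minus M (X 1)
      = density ?L (\<lambda>x. c * (indicator {..<0} x * emeasure N {t. x - t \<in> {0..}}))"
  proof -
    have "{t. x - t \<in> {0..}} = {..x}" for x :: real
      by auto
    moreover have "(\<lambda>x. emeasure N {t. x - t \<in> {0..}}) \<in> borel_measurable borel"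
      by (rule emeasure_measurable) simp
    ultimately show ?thesis
      using density_pi[of "{..<0}" "\<lambda>x. {..x}"]
      by (simp add: pi_minus_def lattice_measure_neg_def assms(6))
  qed
  \<comment> \<open>The shift by \<open>d\<close> exchanges strict and weak inequalities, which
    accounts for the \<open>- d\<close> in the undershoot chains; the two duality statements below
    are read off from it.\<close>
  have gap: "AE w in ?L. (0 \<le> w \<longleftrightarrow> 0 < w + d)
      \<and> emeasure N {t. w + d \<le> t} = emeasure N {t. w < t}
      \<and> emeasure N {t. t < w + d} = emeasure N {t. t \<le> w}"
    using AE_lattice_measure_gap[OF N sets_N span(1) lattice]
  proof eventually_elim
    case (elim w)
    then have AE: "AE t in N. w + d \<le> t \<longleftrightarrow> w < t" by (rule conjunct2)
    have "AE t in N. t \<in> {t. w + d \<le> t} \<longleftrightarrow> t \<in> {t. w < t}"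
      using AE by simp
    moreover have "AE t in N. t \<in> {t. t < w + d} \<longleftrightarrow> t \<in> {t. t \<le> w}"
      by (rule eventually_mono[OF AE]) (metis mem_Collect_eq not_le)
    ultimately have "emeasure N {t. w + d \<le> t} = emeasure N {t. w < t}"
      "emeasure N {t. t < w + d} = emeasure N {t. t \<le> w}"
      by (intro emeasure_eq_AE; simp)+
    with conjunct1[OF elim] show ?case by (intro conjI)
  qed
  have dual_up: "AE w in ?L. indicator {..<0} (- w - d) * emeasure N {t. - w - d + t \<in> {0..}}
        = (indicator {0..} w * emeasure N {t. w - t \<in> {..<0}} :: ennreal)"
    using gap
  proof eventually_elim
    case (elim w)
    have "{t. - w - d + t \<in> {0..}} = {t. w + d \<le> t}" "{t. w - t \<in> {..<0}} = {t. w < t}"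
      by auto
    moreover have "- w - d < 0 \<longleftrightarrow> 0 \<le> w" using conjunct1[OF elim] by linarith
    ultimately show ?case
      using elim by (simp only: indicator_def lessThan_iff atLeast_iff)
  qed
  have dual_down: "AE w in ?L. indicator {0..} (- w - d) * emeasure N {t. - w - d + t \<in> {..<0}}
        = (indicator {..<0} w * emeasure N {t. w - t \<in> {0..}} :: ennreal)"
    using gap
  proof eventually_elim
    case (elim w)
    have "{t. - w - d + t \<in> {..<0}} = {t. t < w + d}" "{t. w - t \<in> {0..}} = {t. t \<le> w}"
      by auto
    moreover have "0 \<le> - w - d \<longleftrightarrow> w < 0" using conjunct1[OF elim] by linarith
    ultimately show ?case
      using elim by (simp only: indicator_def lessThan_iff atLeast_iff)
  qed
  show ?thesis
  proof (intro allI impI)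
    fix n :: nat assume n: "n \<ge> 1"
    have up_half_lines: "(\<exists>c::real. {..<c} \<subseteq> {..<0} \<and> {c<..} \<subseteq> {0..}) \<or> (\<exists>c::real. {c<..} \<subseteq> {..<0} \<and> {..<c} \<subseteq> {0..})"
      by (intro disjI1 exI[of _ 0]) auto
    have down_half_lines: "(\<exists>c::real. {..<c} \<subseteq> {0..} \<and> {c<..} \<subseteq> {..<0}) \<or> (\<exists>c::real. {c<..} \<subseteq> {0..} \<and> {..<c} \<subseteq> {..<0})"
      by (intro disjI2 exI[of _ 0]) auto
    note walk = assms(1-3,5) lattice[unfolded N_def]
    have UNIV: "{0..} \<union> {..<0} = (UNIV :: real set)" "{..<0} \<union> {0..} = (UNIV :: real set)" by auto
    have borel: "{0..} \<in> sets (borel :: real measure)" "{..<0} \<in> sets (borel :: real measure)"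
      by simp_all
    note up = crossing_invariant[OF walk borel UNIV(1) up_half_lines pi_plus[unfolded N_def]
        dual_up[unfolded N_def] n]
      and down = crossing_invariant[OF walk borel(2,1) UNIV(2) down_half_lines pi_minus[unfolded N_def]
        dual_down[unfolded N_def] n]
    show "distr (walk_law_init M X (pi_plus M (X 1))) borel (overshoot_up n) = pi_plus M (X 1)
    \<and> distr (walk_law_init M X (pi_plus M (X 1))) borel (\<lambda>s. - undershoot_up n s - d)
        = pi_plus M (X 1)
    \<and> distr (walk_law_init M X (pi_minus M (X 1))) borel (overshoot_down n) = pi_minus M (X 1)
    \<and> distr (walk_law_init M X (pi_minus M (X 1))) borel (\<lambda>s. - undershoot_down n s - d)
        = pi_minus M (X 1)"
      unfolding overshoot_up_def[abs_def] undershoot_up_def overshoot_down_def[abs_def] undershoot_down_def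
        up_time_eq_crossing_time down_time_eq_crossing_time
      by (intro conjI up down)
  qed
qed

end
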